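(* Let $I=[0,1]$, let $f:I\to I$ be continuous and let $\overline f:\mathcal K(I)\to\mathcal K(I)$ be the map induced by $f$. (1) For every $\varepsilon>0$, if $f$ is generically $\varepsilon$-chaotic, then $\overline f$ is generically $\varepsilon$-chaotic. (2) If $f$ is generically chaotic, then $\overline f$ is generically chaotic. (3) If $\overline f$ is generically chaotic, then $\overline f$ is generically $\varepsilon$-chaotic for some $\varepsilon>0$.
   Context: For a compact metric space $(X,d)$, $\mathcal K(X)$ denotes the set of all non-empty compact subsets of $X$ with the Hausdorff metric $d_H$ (a compact metric space). A continuous map $f:X\to X$ induces the continuous map $\overline f:\mathcal K(X)\to\mathcal K(X)$, $\overline f(K)=f(K)=\{f(x): x\in K\}$. For a continuous map $g:Y\to Y$ of a compact metric space $(Y,\rho)$ and $\varepsilon>0$, let $C(g)$ (resp. $C(g,\varepsilon)$) be the set of pairs $(x,y)\in Y^2$ with $\liminf_{n\to\infty}\rho(g^n(x),g^n(y))=0$ and $\limsup_{n\to\infty}\rho(g^n(x),g^n(y))>0$ (resp. $>\varepsilon$). The map $g$ is generically chaotic (resp. generically $\varepsilon$-chaotic) if $C(g)$ (resp. $C(g,\varepsilon)$) is residual in $Y^2$ (i.e. its complement is of first category: a countable union of nowhere dense sets). For $\overline f$ this is applied with $Y=\mathcal K(X)$, $\rho=d_H$. The interval $I$ carries the metric $|x-y|$. *)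

theory Defs
  imports "HOL-Analysis.Analysis"
begin

section \<open>The hyperspace of non-empty compact subsets\<close>

definition hyperspace_carrier :: "'a metric \<Rightarrow> 'a set set" where
  "hyperspace_carrier m = {K. K \<noteq> {} \<and> compactin (mtopology_of m) K}"

definition point_set_dist :: "'a metric \<Rightarrow> 'a \<Rightarrow> 'a set \<Rightarrow> real" where
  "point_set_dist m x B = (INF y\<in>B. mdist m x y)"

text \<open>The locale \<^locale>\<open>Metric_space\<close> asks for a symmetric and non-negative distance on the whole
  type; hence the value 0 when one of the arguments lies outside the hyperspace.\<close>

definition hausdorff_dist :: "'a metric \<Rightarrow> 'a set \<Rightarrow> 'a set \<Rightarrow> real" where
  "hausdorff_dist m A B =
     (if A \<in> hyperspace_carrier m \<and> B \<in> hyperspace_carrier m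
      then max (SUP x\<in>A. point_set_dist m x B) (SUP y\<in>B. point_set_dist m y A)
      else 0)"

definition hyperspace :: "'a metric \<Rightarrow> 'a set metric" where
  "hyperspace m = metric (hyperspace_carrier m, hausdorff_dist m)"

text \<open>The type \<^typ>\<open>'a metric\<close> is only meaningful on pairs that form a metric space, so we check
  that the Hausdorff distance is a metric.\<close>

lemma hyperspace_carrier_subset: "K \<in> hyperspace_carrier m \<Longrightarrow> K \<subseteq> mspace m"
  unfolding hyperspace_carrier_def using compactin_subset_topspace by fastforce

lemma point_set_dist_le: "y \<in> B \<Longrightarrow> point_set_dist m x B \<le> mdist m x y"
  unfolding point_set_dist_def by (rule cINF_lower) (auto intro!: bdd_belowI2[where m=0])

lemma point_set_dist_greatest:
  "B \<noteq> {} \<Longrightarrow> (\<And>y. y \<in> B \<Longrightarrow> r \<le> mdist m x y) \<Longrightarrow> r \<le> point_set_dist m x B"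
  unfolding point_set_dist_def by (rule cINF_greatest)

lemma point_set_dist_triangle:
  assumes "B \<in> hyperspace_carrier m" "x \<in> mspace m" "y \<in> mspace m"
  shows "point_set_dist m x B \<le> mdist m x y + point_set_dist m y B"
proof -
  have "point_set_dist m x B - mdist m x y \<le> point_set_dist m y B"
  proof (rule point_set_dist_greatest)
    show "B \<noteq> {}" using assms by (auto simp: hyperspace_carrier_def)
    fix z assume z: "z \<in> B"
    then have "z \<in> mspace m" using assms hyperspace_carrier_subset by blast
    then have "mdist m x z \<le> mdist m x y + mdist m y z"
      using assms by (intro mdist_triangle)
    then show "point_set_dist m x B - mdist m x y \<le> mdist m y z"
      using point_set_dist_le[OF z, of m x] by linarith
  qed
  then show ?thesis by linarith
qed

lemma bdd_above_point_set_dist: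
  assumes A: "A \<in> hyperspace_carrier m" and B: "B \<in> hyperspace_carrier m"
  shows "bdd_above ((\<lambda>x. point_set_dist m x B) ` A)"
proof -
  interpret Metric_space "mspace m" "mdist m" by (rule Metric_space_mspace_mdist)
  have "mbounded A"
    using A compactin_imp_mbounded
    by (simp add: hyperspace_carrier_def mtopology_of_def)
  then obtain c r where c: "A \<subseteq> mcball c r" unfolding mbounded_def by blast
  have "A \<noteq> {}" using A by (auto simp: hyperspace_carrier_def)
  then have cm: "c \<in> mspace m" using c by auto
  show ?thesis
  proof (rule bdd_aboveI2)
    fix x assume "x \<in> A"
    then have x: "x \<in> mspace m" "mdist m x c \<le> r" using c by (auto simp: commute)
    show "point_set_dist m x B \<le> r + point_set_dist m c B"
      using point_set_dist_triangle[OF B x(1) cm] x(2) by linarith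
  qed
qed

lemma hausdorff_dist_upper:
  assumes "A \<in> hyperspace_carrier m" "B \<in> hyperspace_carrier m" "x \<in> A"
  shows "point_set_dist m x B \<le> hausdorff_dist m A B"
  using cSUP_upper[OF assms(3) bdd_above_point_set_dist[OF assms(1,2)]] assms
  by (simp add: hausdorff_dist_def)

lemma hausdorff_dist_least:
  assumes "A \<in> hyperspace_carrier m" "B \<in> hyperspace_carrier m"
    and "\<And>x. x \<in> A \<Longrightarrow> point_set_dist m x B \<le> r"
    and "\<And>x. x \<in> B \<Longrightarrow> point_set_dist m x A \<le> r"
  shows "hausdorff_dist m A B \<le> r"
proof -
  have "A \<noteq> {}" "B \<noteq> {}" using assms(1,2) by (auto simp: hyperspace_carrier_def)
  then show ?thesis using assms by (auto simp: hausdorff_dist_def intro!: cSUP_least)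
qed

lemma hausdorff_dist_commute: "hausdorff_dist m A B = hausdorff_dist m B A"
  by (auto simp: hausdorff_dist_def max.commute)

lemma hausdorff_dist_nonneg: "0 \<le> hausdorff_dist m A B"
proof (cases "A \<in> hyperspace_carrier m \<and> B \<in> hyperspace_carrier m")
  case True
  then obtain x where x: "x \<in> A" by (auto simp: hyperspace_carrier_def)
  have "0 \<le> point_set_dist m x B"
    using True by (intro point_set_dist_greatest) (auto simp: hyperspace_carrier_def)
  then show ?thesis using hausdorff_dist_upper[of A m B x] True x by simp
qed (simp only: hausdorff_dist_def if_False order_refl)

lemma point_set_dist_zero_imp:
  assumes B: "B \<in> hyperspace_carrier m" and x: "x \<in> mspace m" and "point_set_dist m x B \<le> 0"
  shows "x \<in> B"
proof -
  interpret Metric_space "mspace m" "mdist m" by (rule Metric_space_mspace_mdist)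
  have ne: "B \<noteq> {}" using B by (auto simp: hyperspace_carrier_def)
  have "x \<in> mtopology closure_of B"
    unfolding metric_closure_of
  proof (safe intro!: x)
    fix r :: real assume r: "0 < r"
    have "\<exists>y\<in>B. mdist m x y < r"
    proof (rule ccontr)
      assume "\<not> ?thesis"
      then have "r \<le> point_set_dist m x B"
        using ne by (intro point_set_dist_greatest) (auto simp: not_less)
      then show False using assms(3) r by linarith
    qed
    then show "\<exists>y\<in>B. y \<in> mball x r"
      using x hyperspace_carrier_subset[OF B] by auto
  qed
  moreover have "closedin mtopology B"
    using B compactin_imp_closedin[OF Hausdorff_space_mtopology]
    by (simp add: hyperspace_carrier_def mtopology_of_def)
  ultimately show ?thesis by (simp add: closure_of_closedin)
qed

lemma hausdorff_dist_triangle_aux: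
  assumes A: "A \<in> hyperspace_carrier m" and B: "B \<in> hyperspace_carrier m"
    and C: "C \<in> hyperspace_carrier m" and x: "x \<in> A"
  shows "point_set_dist m x C \<le> hausdorff_dist m A B + hausdorff_dist m B C"
proof -
  have "point_set_dist m x C - hausdorff_dist m B C \<le> point_set_dist m x B"
  proof (rule point_set_dist_greatest)
    show "B \<noteq> {}" using B by (auto simp: hyperspace_carrier_def)
    fix y assume y: "y \<in> B"
    have "point_set_dist m x C \<le> mdist m x y + point_set_dist m y C"
      using hyperspace_carrier_subset A B x y by (intro point_set_dist_triangle C) blast+
    then show "point_set_dist m x C - hausdorff_dist m B C \<le> mdist m x y"
      using hausdorff_dist_upper[OF B C y] by linarith
  qed
  then show ?thesis using hausdorff_dist_upper[OF A B x] by linarith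
qed

lemma Metric_space_hyperspace: "Metric_space (hyperspace_carrier m) (hausdorff_dist m)"
proof
  fix A B C assume A: "A \<in> hyperspace_carrier m" and B: "B \<in> hyperspace_carrier m"
  have sub: "X \<subseteq> Y"
    if X: "X \<in> hyperspace_carrier m" and Y: "Y \<in> hyperspace_carrier m" and "hausdorff_dist m X Y = 0"
    for X Y
  proof
    fix x assume x: "x \<in> X"
    show "x \<in> Y"
    proof (rule point_set_dist_zero_imp[OF Y])
      show "x \<in> mspace m" using hyperspace_carrier_subset[OF X] x by blast
      show "point_set_dist m x Y \<le> 0" using hausdorff_dist_upper[OF X Y x] that(3) by simp
    qed
  qed
  show "hausdorff_dist m A B = 0 \<longleftrightarrow> A = B"
  proof
    assume "hausdorff_dist m A B = 0"
    then show "A = B" using sub[OF A B] sub[OF B A] hausdorff_dist_commute[of m A B] by simp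
  next
    assume "A = B"
    have "hausdorff_dist m A A \<le> 0"
    proof (rule hausdorff_dist_least[OF A A])
      fix x assume x: "x \<in> A"
      then have "x \<in> mspace m" using hyperspace_carrier_subset[OF A] by blast
      then have "mdist m x x = 0" by simp
      then have "point_set_dist m x A \<le> 0" using point_set_dist_le[OF x, of m x] by linarith
      then show "point_set_dist m x A \<le> 0" "point_set_dist m x A \<le> 0" by simp_all
    qed
    then show "hausdorff_dist m A B = 0"
      using hausdorff_dist_nonneg[of m A A] \<open>A = B\<close> by simp
  qed
  assume C: "C \<in> hyperspace_carrier m"
  show "hausdorff_dist m A C \<le> hausdorff_dist m A B + hausdorff_dist m B C"
  proof (rule hausdorff_dist_least[OF A C])
    fix x assume "x \<in> C"
    then show "point_set_dist m x A \<le> hausdorff_dist m A B + hausdorff_dist m B C"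
      using hausdorff_dist_triangle_aux[OF C B A, of x] hausdorff_dist_commute[of m] by simp
  qed (rule hausdorff_dist_triangle_aux[OF A B C])
qed (rule hausdorff_dist_nonneg hausdorff_dist_commute)+

lemma mspace_hyperspace: "mspace (hyperspace m) = hyperspace_carrier m"
  and mdist_hyperspace: "mdist (hyperspace m) = hausdorff_dist m"
  by (simp_all add: hyperspace_def Metric_space.mspace_metric Metric_space.mdist_metric
        Metric_space_hyperspace)

section \<open>Baire category\<close>

definition nowhere_dense_in :: "'a topology \<Rightarrow> 'a set \<Rightarrow> bool" where
  "nowhere_dense_in T S \<longleftrightarrow> S \<subseteq> topspace T \<and> T interior_of (T closure_of S) = {}"

definition first_category_in :: "'a topology \<Rightarrow> 'a set \<Rightarrow> bool" where
  "first_category_in T S \<longleftrightarrow>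
     (\<exists>\<N>. countable \<N> \<and> (\<forall>N\<in>\<N>. nowhere_dense_in T N) \<and> S = \<Union>\<N>)"

definition residual_in :: "'a topology \<Rightarrow> 'a set \<Rightarrow> bool" where
  "residual_in T S \<longleftrightarrow> S \<subseteq> topspace T \<and> first_category_in T (topspace T - S)"

section \<open>Generic chaos\<close>

text \<open>Lower and upper limits are taken in \<^typ>\<open>ereal\<close>, a complete lattice; on a bounded metric
  space they agree with those in the reals.\<close>

definition chaotic_pairs :: "'a metric \<Rightarrow> ('a \<Rightarrow> 'a) \<Rightarrow> ('a \<times> 'a) set" where
  "chaotic_pairs m g =
     {(x, y) \<in> mspace m \<times> mspace m.
        liminf (\<lambda>n. ereal (mdist m ((g ^^ n) x) ((g ^^ n) y))) = 0 \<and>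
        limsup (\<lambda>n. ereal (mdist m ((g ^^ n) x) ((g ^^ n) y))) > 0}"

definition eps_chaotic_pairs :: "'a metric \<Rightarrow> ('a \<Rightarrow> 'a) \<Rightarrow> real \<Rightarrow> ('a \<times> 'a) set" where
  "eps_chaotic_pairs m g \<epsilon> =
     {(x, y) \<in> mspace m \<times> mspace m.
        liminf (\<lambda>n. ereal (mdist m ((g ^^ n) x) ((g ^^ n) y))) = 0 \<and>
        limsup (\<lambda>n. ereal (mdist m ((g ^^ n) x) ((g ^^ n) y))) > ereal \<epsilon>}"

definition generically_chaotic :: "'a metric \<Rightarrow> ('a \<Rightarrow> 'a) \<Rightarrow> bool" where
  "generically_chaotic m g \<longleftrightarrow>
     residual_in (prod_topology (mtopology_of m) (mtopology_of m)) (chaotic_pairs m g)"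

definition generically_eps_chaotic :: "'a metric \<Rightarrow> real \<Rightarrow> ('a \<Rightarrow> 'a) \<Rightarrow> bool" where
  "generically_eps_chaotic m \<epsilon> g \<longleftrightarrow>
     residual_in (prod_topology (mtopology_of m) (mtopology_of m)) (eps_chaotic_pairs m g \<epsilon>)"

section \<open>The unit interval and the induced map\<close>

abbreviation unit_interval :: "real metric" where
  "unit_interval \<equiv> submetric euclidean_metric {0..1}"

abbreviation induced_map :: "('a \<Rightarrow> 'a) \<Rightarrow> 'a set \<Rightarrow> 'a set" where
  "induced_map f \<equiv> (\<lambda>K. f ` K)"

end

theory Submission
  imports Defs
begin

text \<open>If \<open>f\<close> or its induced map is generically chaotic, then any two nondegenerate intervals have
  arbitrarily close images, and no interval is eventually shrunk to a point. For interval maps this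
  already forces two of any three intervals to have overlapping images at a common time: each
  interval reaches a periodic point, and three intervals that never overlap would keep their order,
  so that the middle one separates the outer two. Hence the members of any finite family of
  intervals eventually contain one of at most two intervals, which makes finite sets, and so a
  dense set of pairs in the hyperspace, simultaneously proximal. The same dichotomy turns a local
  lower bound on the separation, provided by the Baire category theorem, into one valid for all
  intervals; this is why no part of \<open>\<epsilon>\<close> is lost, and why some positive \<open>\<epsilon>\<close> exists.\<close>

section \<open>Interval maps\<close>

text \<open>A ball in the hyperspace contains finite sets whose points may be chosen freely in
  prescribed intervals, but the number of these intervals is unbounded, and closeness of single
  pairs of intervals gives no common time for several pairs. This is why the reduction to two is
  decisive: only one pair is then left to bring together. Two cannot be lowered to one: if f leaves
  [0,1/2] and [1/2,1] invariant, fixes 1/2 and is locally eventually onto on each half, intervals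
  from different halves have images that share at most that point. The bound above \<epsilon> has to
  be one constant for all intervals: the countably many open conditions "distance above \<epsilon>
  at some late time" together give only an upper limit of at least \<epsilon>. Generic chaos is
  generic \<epsilon>-chaos for \<epsilon> = 0, and f acts on points as the induced map does on
  singletons; thus all three claims follow from \<open>hyperspace_generically_chaotic\<close>, whose
  constant exceeds \<epsilon> strictly.\<close>

definition ivls :: "real set set" where
  "ivls = {{a..b} | a b. 0 \<le> a \<and> a < b \<and> b \<le> 1}"

lemma ivlsI: "0 \<le> a \<Longrightarrow> a < b \<Longrightarrow> b \<le> 1 \<Longrightarrow> {a..b} \<in> ivls"
  unfolding ivls_def by blast

lemma ivlsE:
  assumes "J \<in> ivls"
  obtains a b where "J = {a..b}" "0 \<le> a" "a < b" "b \<le> 1"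
  using assms unfolding ivls_def by blast

lemma ivls_subset: "J \<in> ivls \<Longrightarrow> J \<subseteq> {0..1}"
  by (auto simp: ivls_def)

lemma ivls_nonempty: "J \<in> ivls \<Longrightarrow> J \<noteq> {}"
  by (auto simp: ivls_def)

lemma ivls_between:
  assumes "J \<in> ivls" "x \<in> J" "y \<in> J" "x \<le> z" "z \<le> y"
  shows "z \<in> J"
  using assms by (auto simp: ivls_def)

lemma ivls_two_points:
  assumes "J \<in> ivls"
  obtains x y where "x \<in> J" "y \<in> J" "x < y"
proof -
  obtain a b where "J = {a..b}" "a < b" using assms by (rule ivlsE)
  then show thesis by (intro that[of a b]) auto
qed

lemma ivls_hull:
  assumes "J \<in> ivls" "x \<in> J" "y \<in> J" "x < y"
  shows "{x..y} \<in> ivls" "{x..y} \<subseteq> J"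
  using assms by (auto simp: ivls_def)

lemma ivls_Int:
  assumes "J \<in> ivls" "L \<in> ivls" "x \<in> J" "y \<in> J" "x \<in> L" "y \<in> L" "x < y"
  shows "\<exists>K\<in>ivls. K \<subseteq> J \<inter> L"
  using ivls_hull[OF assms(1,3,4,7)] ivls_hull[OF assms(2,5,6,7)] by blast

text \<open>The point p may be an end point of J, but J is nondegenerate and so extends to at least
  one side of p, where L extends as well.\<close>

lemma ivls_Int_nbhd:
  assumes J: "J \<in> ivls" and L: "L \<in> ivls" and p: "p \<in> J"
    and x: "x \<in> L" and y: "y \<in> L" and xy: "x < p" "p < y"
  shows "\<exists>K\<in>ivls. K \<subseteq> J \<inter> L"
proof -
  obtain a b where ab: "J = {a..b}" "a < b" using J by (rule ivlsE)
  have "max a x < min b y" using ab p xy by auto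
  moreover have "max a x \<in> J" "min b y \<in> J" using ab p xy by auto
  moreover have "max a x \<in> L" "min b y \<in> L"
    using ivls_between[OF L x y] ab p xy by auto
  ultimately show ?thesis using ivls_Int[OF J L] by blast
qed

lemma ivlsI_connected:
  assumes "connected J" "compact J" "J \<subseteq> {0..1}" "x \<in> J" "y \<in> J" "x \<noteq> y"
  shows "J \<in> ivls"
proof -
  obtain a b where J: "J = {a..b}" using connected_compact_interval_1[of J] assms by auto
  then show ?thesis using assms by (auto intro!: ivlsI)
qed

section \<open>Iterates of interval maps and the spreading property\<close>

locale interval_map =
  fixes f :: "real \<Rightarrow> real"
  assumes cont: "continuous_on {0..1} f"
    and maps: "f \<in> {0..1} \<rightarrow> {0..1}"
begin

lemma funpow_maps: "x \<in> {0..1} \<Longrightarrow> (f ^^ n) x \<in> {0..1}"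
  using maps by (induction n) auto

lemma funpow_image_subset: "J \<subseteq> {0..1} \<Longrightarrow> (f ^^ n) ` J \<subseteq> {0..1}"
  using funpow_maps by blast

lemma funpow_cont: "continuous_on {0..1} (f ^^ n)"
proof (induction n)
  case (Suc n)
  have "(f ^^ n) ` {0..1} \<subseteq> {0..1}" by (rule funpow_image_subset) simp
  then show ?case using continuous_on_compose[OF Suc, of f] cont
    by (simp add: continuous_on_subset comp_def)
qed (simp add: id_def)

lemma funpow_image_add: "(f ^^ (m + n)) ` J = (f ^^ m) ` (f ^^ n) ` J"
  by (simp add: funpow_add image_comp)

lemma funpow_image_Suc: "(f ^^ Suc n) ` J = f ` (f ^^ n) ` J"
  by (simp add: image_comp)

lemma funpow_image_commute: "(f ^^ m) ` (f ^^ n) ` J = (f ^^ n) ` (f ^^ m) ` J"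
  by (simp add: funpow_image_add[symmetric] add.commute)

lemma funpow_uniform:
  assumes "e > 0"
  obtains d where "d > 0"
    "\<And>x y. x \<in> {0..1} \<Longrightarrow> y \<in> {0..1} \<Longrightarrow> \<bar>x - y\<bar> < d \<Longrightarrow> \<bar>(f ^^ n) x - (f ^^ n) y\<bar> < e"
proof -
  have "uniformly_continuous_on {0..1} (f ^^ n)"
    using funpow_cont compact_uniformly_continuous by blast
  then obtain d where "d > 0"
    "\<forall>x\<in>{0..1}. \<forall>y\<in>{0..1}. dist y x < d \<longrightarrow> dist ((f ^^ n) y) ((f ^^ n) x) < e"
    using assms unfolding uniformly_continuous_on_def by blast
  then show thesis by (intro that[of d]) (auto simp: dist_real_def)
qed

text \<open>One d for all iterates up to the k-th: replacing a time by a neighbouring multiple of k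
  costs at most k steps.\<close>

lemma funpow_uniform_le:
  assumes "e > 0"
  obtains d where "d > 0"
    "\<And>x y n. n \<le> k \<Longrightarrow> x \<in> {0..1} \<Longrightarrow> y \<in> {0..1} \<Longrightarrow> \<bar>x - y\<bar> < d \<Longrightarrow>
      \<bar>(f ^^ n) x - (f ^^ n) y\<bar> < e"
proof (atomize_elim, induction k)
  case 0
  then show ?case using assms by auto
next
  case (Suc k)
  then obtain d where d: "d > 0"
    "\<And>x y n. n \<le> k \<Longrightarrow> x \<in> {0..1} \<Longrightarrow> y \<in> {0..1} \<Longrightarrow> \<bar>x - y\<bar> < d \<Longrightarrow>
      \<bar>(f ^^ n) x - (f ^^ n) y\<bar> < e" by blast
  obtain d' where d': "d' > 0" "\<And>x y. x \<in> {0..1} \<Longrightarrow> y \<in> {0..1} \<Longrightarrow> \<bar>x - y\<bar> < d' \<Longrightarrow>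
      \<bar>(f ^^ Suc k) x - (f ^^ Suc k) y\<bar> < e" by (rule funpow_uniform[OF assms, of "Suc k"]) blast
  show ?case
    by (rule exI[of _ "min d d'"]) (use d d' in \<open>auto simp: le_Suc_eq simp del: funpow.simps\<close>)
qed

lemma funpow_image_ivls:
  assumes "J \<in> ivls" "x \<in> J" "y \<in> J" "(f ^^ n) x \<noteq> (f ^^ n) y"
  shows "(f ^^ n) ` J \<in> ivls"
proof (rule ivlsI_connected)
  have "continuous_on J (f ^^ n)"
    using funpow_cont ivls_subset[OF assms(1)] continuous_on_subset by blast
  moreover have "connected J" "compact J" using assms(1) by (auto simp: ivls_def)
  ultimately show "connected ((f ^^ n) ` J)" "compact ((f ^^ n) ` J)"
    using connected_continuous_image compact_continuous_image by blast+
  show "(f ^^ n) ` J \<subseteq> {0..1}" using funpow_image_subset ivls_subset[OF assms(1)] by blast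
qed (use assms in auto)

text \<open>Continuity at a preimage of the midpoint of M. In this way a restriction on the image at
  time n is imposed by shrinking the initial interval.\<close>

lemma ivls_preimage:
  assumes J: "J \<in> ivls" and M: "M \<in> ivls" and sub: "M \<subseteq> (f ^^ n) ` J"
  shows "\<exists>K\<in>ivls. K \<subseteq> J \<and> (f ^^ n) ` K \<subseteq> M"
proof -
  obtain a b where ab: "J = {a..b}" "0 \<le> a" "a < b" "b \<le> 1" using J by (rule ivlsE)
  obtain c e where ce: "M = {c..e}" "c < e" using M by (rule ivlsE)
  define u where "u = (c + e) / 2"
  have "u \<in> M" using ce by (simp add: u_def)
  then obtain x where x: "x \<in> J" "(f ^^ n) x = u" using sub by auto
  have "(e - c) / 2 > 0" using ce by simp
  then obtain d where d: "d > 0" "\<And>x y. x \<in> {0..1} \<Longrightarrow> y \<in> {0..1} \<Longrightarrow> \<bar>x - y\<bar> < d \<Longrightarrow>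
      \<bar>(f ^^ n) x - (f ^^ n) y\<bar> < (e - c) / 2" using funpow_uniform by blast
  define K where "K = {max a (x - d/2)..min b (x + d/2)}"
  have "K \<in> ivls" unfolding K_def using ab x d(1) by (intro ivlsI) auto
  moreover have "K \<subseteq> J" unfolding K_def ab by auto
  moreover have "(f ^^ n) y \<in> M" if "y \<in> K" for y
  proof -
    have "\<bar>y - x\<bar> < d" using that d(1) unfolding K_def by auto
    moreover have "y \<in> {0..1}" "x \<in> {0..1}" using that x \<open>K \<subseteq> J\<close> ivls_subset[OF J] by blast+
    ultimately have "\<bar>(f ^^ n) y - u\<bar> < (e - c) / 2"
      using d(2)[of y x] x by simp
    then show ?thesis unfolding ce u_def by (auto simp: abs_less_iff field_simps)
  qed
  ultimately show ?thesis by blast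
qed

end

text \<open>What the interval dynamics uses of generic chaos, put in terms of intervals alone, so
  that it can be derived from points and from sets alike and is inherited by iterates and by the
  reflected map. The time in \<open>prox\<close> is not controlled, and d in \<open>sep\<close> may
  depend on J.\<close>

locale spreading_map = interval_map +
  assumes prox: "J \<in> ivls \<Longrightarrow> L \<in> ivls \<Longrightarrow> \<delta> > 0 \<Longrightarrow>
      \<exists>n. \<exists>x\<in>J. \<exists>y\<in>L. \<bar>(f ^^ n) x - (f ^^ n) y\<bar> < \<delta>"
    and sep: "J \<in> ivls \<Longrightarrow>
      \<exists>d>0. \<forall>N. \<exists>n\<ge>N. \<exists>x\<in>J. \<exists>y\<in>J. d \<le> \<bar>(f ^^ n) x - (f ^^ n) y\<bar>"
begin

text \<open>Points that are apart at some time m \<ge> n are already distinct at time n, and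
  \<open>sep\<close> provides arbitrarily late such m.\<close>

lemma image_ivls [simp]:
  assumes "J \<in> ivls"
  shows "(f ^^ n) ` J \<in> ivls"
proof -
  obtain d where d: "d > 0" "\<forall>N. \<exists>n\<ge>N. \<exists>x\<in>J. \<exists>y\<in>J. d \<le> \<bar>(f ^^ n) x - (f ^^ n) y\<bar>"
    using sep[OF assms] by blast
  then obtain m x y where m: "m \<ge> n" "x \<in> J" "y \<in> J" "d \<le> \<bar>(f ^^ m) x - (f ^^ m) y\<bar>" by blast
  have "(f ^^ m) z = (f ^^ (m - n)) ((f ^^ n) z)" for z
    using m(1) by (metis comp_apply funpow_add le_add_diff_inverse2)
  then have "(f ^^ n) x \<noteq> (f ^^ n) y" using m d(1) by auto
  then show ?thesis using funpow_image_ivls assms m by blast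
qed

text \<open>The images at time N are again intervals, so \<open>prox\<close> applied to them yields
  a time that is at least N for the original pair.\<close>

lemma prox_ge:
  assumes "J \<in> ivls" "L \<in> ivls" "\<delta> > 0"
  shows "\<exists>n\<ge>N. \<exists>x\<in>J. \<exists>y\<in>L. \<bar>(f ^^ n) x - (f ^^ n) y\<bar> < \<delta>"
proof -
  obtain n x y where "x \<in> (f ^^ N) ` J" "y \<in> (f ^^ N) ` L" "\<bar>(f ^^ n) x - (f ^^ n) y\<bar> < \<delta>"
    using prox[of "(f ^^ N) ` J" "(f ^^ N) ` L" \<delta>] assms by auto
  then show ?thesis
    by (intro exI[of _ "n + N"]) (auto simp: funpow_add)
qed

end

text \<open>For \<open>prox\<close> the time is rounded up to a multiple of k, for
  \<open>sep\<close> it is rounded down; uniform continuity of the iterates up to the k-th controls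
  the change in distance.\<close>

lemma spreading_map_iterate:
  assumes "spreading_map f" "k \<ge> 1"
  shows "spreading_map (f ^^ k)"
proof -
  interpret spreading_map f by fact
  show ?thesis
  proof
    show "continuous_on {0..1} (f ^^ k)" by (rule funpow_cont)
    show "f ^^ k \<in> {0..1} \<rightarrow> {0..1}" using funpow_maps by blast
  next
    fix J L and \<delta> :: real assume JL: "J \<in> ivls" "L \<in> ivls" "\<delta> > 0"
    obtain d where d: "d > 0"
      "\<And>x y n. n \<le> k \<Longrightarrow> x \<in> {0..1} \<Longrightarrow> y \<in> {0..1} \<Longrightarrow> \<bar>x - y\<bar> < d \<Longrightarrow>
      \<bar>(f ^^ n) x - (f ^^ n) y\<bar> < \<delta>" using funpow_uniform_le[OF JL(3)] by blast
    obtain n x y where n: "x \<in> J" "y \<in> L" "\<bar>(f ^^ n) x - (f ^^ n) y\<bar> < d"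
      using prox[OF JL(1,2) d(1)] by blast
    \<comment> \<open>r lies between 1 and k: if k divides n, a whole further period is added, which
      does no harm.\<close>
    define r where "r = k - n mod k"
    have nr: "r + n = k * (n div k + 1)" "r \<le> k"
      using assms(2) mod_less_divisor[of k n] mult_div_mod_eq[of k n]
      unfolding r_def distrib_left by linarith+
    have "\<bar>(f ^^ r) ((f ^^ n) x) - (f ^^ r) ((f ^^ n) y)\<bar> < \<delta>"
      using d(2)[OF nr(2) _ _ n(3)] funpow_maps ivls_subset JL n by blast
    then show "\<exists>n. \<exists>x\<in>J. \<exists>y\<in>L. \<bar>((f ^^ k) ^^ n) x - ((f ^^ k) ^^ n) y\<bar> < \<delta>"
      using n nr(1) by (metis comp_apply funpow_add funpow_mult)
  next
    fix J assume J: "J \<in> ivls"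
    obtain e where e: "e > 0" "\<forall>N. \<exists>n\<ge>N. \<exists>x\<in>J. \<exists>y\<in>J. e \<le> \<bar>(f ^^ n) x - (f ^^ n) y\<bar>"
      using sep[OF J] by blast
    obtain d where d: "d > 0"
      "\<And>x y n. n \<le> k \<Longrightarrow> x \<in> {0..1} \<Longrightarrow> y \<in> {0..1} \<Longrightarrow> \<bar>x - y\<bar> < d \<Longrightarrow>
      \<bar>(f ^^ n) x - (f ^^ n) y\<bar> < e" using funpow_uniform_le[OF e(1)] by blast
    have "\<exists>n\<ge>N. \<exists>x\<in>J. \<exists>y\<in>J. d \<le> \<bar>((f ^^ k) ^^ n) x - ((f ^^ k) ^^ n) y\<bar>" for N
    proof -
      obtain n x y where n: "n \<ge> k * N" "x \<in> J" "y \<in> J" "e \<le> \<bar>(f ^^ n) x - (f ^^ n) y\<bar>"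
        using e(2) by blast
      define q where "q = n div k"
      define r where "r = n mod k"
      have nr: "n = r + k * q" "r \<le> k" using assms(2) by (auto simp: q_def r_def)
      have "q \<ge> N" using n(1) assms(2) unfolding q_def
        by (metis div_le_mono nonzero_mult_div_cancel_left not_one_le_zero)
      moreover have "d \<le> \<bar>(f ^^ (k * q)) x - (f ^^ (k * q)) y\<bar>"
      proof (rule ccontr)
        assume "\<not> ?thesis"
        then have "\<bar>(f ^^ r) ((f ^^ (k * q)) x) - (f ^^ r) ((f ^^ (k * q)) y)\<bar> < e"
          using d(2)[OF nr(2)] funpow_maps ivls_subset[OF J] n by (meson not_le subsetD)
        then show False using n(4) unfolding nr(1) by (simp add: funpow_add)
      qed
      ultimately show ?thesis using n(2,3) by (auto simp: funpow_mult)
    qed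
    then show "\<exists>d>0. \<forall>N. \<exists>n\<ge>N. \<exists>x\<in>J. \<exists>y\<in>J. d \<le> \<bar>((f ^^ k) ^^ n) x - ((f ^^ k) ^^ n) y\<bar>"
      using d(1) by blast
  qed
qed

text \<open>The conjugate of f under the reflection of the unit interval. It reverses the order, so
  that arguments about moving right or lying on the right are made only once.\<close>

definition mirror :: "(real \<Rightarrow> real) \<Rightarrow> real \<Rightarrow> real" where
  "mirror f = (\<lambda>x. 1 - f (1 - x))"

lemma mirror_funpow: "(mirror f ^^ n) x = 1 - (f ^^ n) (1 - x)"
  by (induction n) (auto simp: mirror_def)

lemma mirror_image: "(mirror f ^^ n) ` (\<lambda>x. 1 - x) ` J = (\<lambda>x. 1 - x) ` (f ^^ n) ` J"
  by (auto simp: mirror_funpow image_iff)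

lemma mirror_ivls: "J \<in> ivls \<Longrightarrow> (\<lambda>x. 1 - x) ` J \<in> ivls"
  by (auto elim!: ivlsE intro!: ivlsI)

lemma spreading_map_mirror:
  assumes "spreading_map f"
  shows "spreading_map (mirror f)"
proof -
  interpret spreading_map f by fact
  show ?thesis
  proof
    show "continuous_on {0..1} (mirror f)" unfolding mirror_def
      by (intro continuous_intros continuous_on_compose2[OF cont]) auto
    show "mirror f \<in> {0..1} \<rightarrow> {0..1}" unfolding mirror_def using maps by fastforce
  next
    fix J L and \<delta> :: real assume JL: "J \<in> ivls" "L \<in> ivls" "\<delta> > 0"
    obtain n x y where n: "x \<in> (\<lambda>x. 1 - x) ` J" "y \<in> (\<lambda>x. 1 - x) ` L" "\<bar>(f ^^ n) x - (f ^^ n) y\<bar> < \<delta>"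
      using prox[OF mirror_ivls mirror_ivls, OF JL] by blast
    then show "\<exists>n. \<exists>x\<in>J. \<exists>y\<in>L. \<bar>(mirror f ^^ n) x - (mirror f ^^ n) y\<bar> < \<delta>"
      unfolding mirror_funpow by (auto simp: abs_minus_commute intro!: exI[of _ n])
  next
    fix J assume "J \<in> ivls"
    from sep[OF mirror_ivls[OF this]]
    show "\<exists>d>0. \<forall>N. \<exists>n\<ge>N. \<exists>x\<in>J. \<exists>y\<in>J. d \<le> \<bar>(mirror f ^^ n) x - (mirror f ^^ n) y\<bar>"
      unfolding mirror_funpow by (auto simp: abs_minus_commute)
  qed
qed

section \<open>Recurrence and periodic points in images of intervals\<close>

context spreading_map
begin

text \<open>Pigeonhole principle: infinitely many images have length at least d, only finitely many
  multiples of d are available, so two images at different times share one of them.\<close>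

lemma returning_interval:
  assumes "J \<in> ivls"
  obtains n k where "k \<ge> 1" "(f ^^ n) ` J \<inter> (f ^^ (n + k)) ` J \<noteq> {}"
proof -
  obtain d where d: "d > 0" "\<forall>N. \<exists>n\<ge>N. \<exists>x\<in>J. \<exists>y\<in>J. d \<le> \<bar>(f ^^ n) x - (f ^^ n) y\<bar>"
    using sep[OF assms] by blast
  define A where "A = {n. \<exists>x\<in>J. \<exists>y\<in>J. d \<le> \<bar>(f ^^ n) x - (f ^^ n) y\<bar>}"
  have inf: "infinite A" using d(2) unfolding A_def infinite_nat_iff_unbounded_le by auto
  \<comment> \<open>An image of length at least d contains a multiple of d.\<close>
  have "\<exists>i\<in>{0..\<lceil>1 / d\<rceil>}. of_int i * d \<in> (f ^^ n) ` J" if "n \<in> A" for n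
  proof -
    obtain x y where xy: "x \<in> (f ^^ n) ` J" "y \<in> (f ^^ n) ` J" "d \<le> y - x"
    proof -
      obtain u v where uv: "u \<in> (f ^^ n) ` J" "v \<in> (f ^^ n) ` J" "d \<le> \<bar>u - v\<bar>"
        using \<open>n \<in> A\<close> unfolding A_def by blast
      then consider "d \<le> v - u" | "d \<le> u - v" by linarith
      then show thesis using uv that by cases blast+
    qed
    have r: "x \<in> {0..1}" "y \<in> {0..1}" using xy funpow_image_subset ivls_subset[OF assms] by blast+
    define i where "i = \<lceil>x / d\<rceil>"
    have "x / d \<le> of_int i" "of_int i < x / d + 1" unfolding i_def by linarith+
    then have i: "x \<le> of_int i * d" "of_int i * d < x + d" using d(1) by (simp_all add: field_simps)
    have "of_int i * d \<in> (f ^^ n) ` J"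
      by (rule ivls_between[OF image_ivls[OF assms] xy(1,2)]) (use i xy in linarith)+
    moreover have "0 \<le> x / d" using r d(1) by simp
    then have "0 \<le> i" unfolding i_def by linarith
    moreover have "i \<le> \<lceil>1 / d\<rceil>" using r d(1) unfolding i_def by (intro ceiling_mono divide_right_mono) auto
    ultimately show ?thesis by auto
  qed
  then obtain i where "infinite {n\<in>A. of_int i * d \<in> (f ^^ n) ` J}"
    using pigeonhole_infinite_rel[OF inf, of "{0..\<lceil>1 / d\<rceil>}" "\<lambda>n i. of_int i * d \<in> (f ^^ n) ` J"]
    by auto
  then obtain n m where "n < m" "of_int i * d \<in> (f ^^ n) ` J" "of_int i * d \<in> (f ^^ m) ` J"
    unfolding infinite_nat_iff_unbounded by blast
  then show thesis by (intro that[of "m - n" n]) auto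
qed

text \<open>Otherwise the map moves every point of the connected set swept out by the interval to the
  right, and the images shrink to its right end point.\<close>

lemma not_all_moved_right:
  assumes J: "J \<in> ivls" and meet: "J \<inter> f ` J \<noteq> {}"
  shows "\<exists>n. \<exists>x\<in>(f ^^ n) ` J. f x \<le> x"
proof (rule ccontr)
  assume "\<not> ?thesis"
  then have right: "x < f x" if "x \<in> (f ^^ n) ` J" for x n
    using that not_le by blast
  define U where "U = (\<Union>n. (f ^^ n) ` J)"
  have meet': "(f ^^ n) ` J \<inter> (f ^^ Suc n) ` J \<noteq> {}" for n
  proof -
    have "(f ^^ n) ` (J \<inter> f ` J) \<subseteq> (f ^^ n) ` J \<inter> (f ^^ Suc n) ` J"
      by (auto simp: image_comp[symmetric] funpow_swap1)
    then show ?thesis using meet by blast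
  qed
  have "\<exists>a b. (f ^^ n) ` J = {a..b} \<and> a < b" for n using image_ivls[OF J, of n] by (auto elim!: ivlsE)
  then obtain a b where ab: "\<And>n. (f ^^ n) ` J = {a n..b n}" "\<And>n. a n < b n" by metis
  have step: "f x \<in> {a (Suc n)..b (Suc n)}" if "x \<in> {a n..b n}" for x n
    using that unfolding ab(1)[symmetric] funpow_image_Suc by blast
  have pre: "\<exists>x\<in>{a n..b n}. y = f x" if "y \<in> {a (Suc n)..b (Suc n)}" for y n
    using that unfolding ab(1)[symmetric] funpow_image_Suc by blast
  have right': "x < f x" if "x \<in> {a n..b n}" for x n using right[of x n] that ab(1) by blast
  have a_mono: "a n < a (Suc n)" for n
  proof -
    have "a (Suc n) \<in> {a (Suc n)..b (Suc n)}" using ab(2)[of "Suc n"] by auto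
    then obtain x where "x \<in> {a n..b n}" "a (Suc n) = f x" using pre by blast
    then show ?thesis using right'[of x n] by auto
  qed
  have b_mono: "b n < b (Suc n)" for n
  proof -
    have "b n \<in> {a n..b n}" using ab(2)[of n] by auto
    then show ?thesis using right'[of "b n" n] step[of "b n" n] by auto
  qed
  have unit: "0 \<le> a n" "b n \<le> 1" for n
    using ivls_subset[OF image_ivls[OF J], of n] ab(2)[of n] unfolding ab(1) by auto
  have bd: "bdd_above (range a)" "bdd_above (range b)"
    using unit order.trans[OF less_imp_le[OF ab(2)] unit(2)] by (auto intro!: bdd_aboveI2[where M=1])
  have lim_a: "a \<longlonglongrightarrow> (SUP n. a n)"
    by (rule LIMSEQ_incseq_SUP[OF bd(1)]) (simp add: incseq_SucI a_mono less_imp_le)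
  define \<alpha> where "\<alpha> = (SUP n. a n)"
  define \<beta> where "\<beta> = (SUP n. b n)"
  have a_le: "a n \<le> \<alpha>" and b_le: "b n \<le> \<beta>" for n
    unfolding \<alpha>_def \<beta>_def using bd by (auto intro: cSUP_upper)
  \<comment> \<open>Consecutive images meet, so the images up to time n leave no gap between a 0 and
    b n.\<close>
  have cover: "\<exists>m. x \<in> {a m..b m}" if "a 0 \<le> x" "x \<le> b n" for x n
    using that(2)
  proof (induction n)
    case 0
    then show ?case using that(1) by auto
  next
    case (Suc n)
    have "a (Suc n) \<le> b n" using meet'[of n] unfolding ab(1) by auto
    then have "x \<in> {a (Suc n)..b (Suc n)}" if "\<not> x \<le> b n" using that Suc.prems by auto
    then show ?case using Suc.IH by blast
  qed
  \<comment> \<open>If \<alpha> < \<beta>, the images cover the compact interval [a 0, \<alpha>], on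
    which f x - x then has a positive minimum c; the left ends grow by at least c in each step and
    leave [0,1].\<close>
  have "\<alpha> = \<beta>"
  proof (rule ccontr)
    assume "\<alpha> \<noteq> \<beta>"
    have "\<alpha> \<le> \<beta>" unfolding \<alpha>_def
      by (rule cSUP_least) (use order.trans[OF less_imp_le[OF ab(2)] b_le] in auto)
    then have "\<alpha> < \<beta>" using \<open>\<alpha> \<noteq> \<beta>\<close> by simp
    then obtain N where N: "\<alpha> < b N" unfolding \<beta>_def using less_cSUP_iff[OF _ bd(2)] by auto
    have mv: "x < f x" if x: "x \<in> {a 0..\<alpha>}" for x
    proof -
      obtain m where "x \<in> {a m..b m}" using cover[of x N] x N by auto
      then show ?thesis by (rule right')
    qed
    have "continuous_on {a 0..\<alpha>} (\<lambda>x. f x - x)"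
      using N unit(1)[of 0] unit(2)[of N] by (intro continuous_intros continuous_on_subset[OF cont]) auto
    then obtain x0 where x0: "x0 \<in> {a 0..\<alpha>}" "\<And>x. x \<in> {a 0..\<alpha>} \<Longrightarrow> f x0 - x0 \<le> f x - x"
      using continuous_attains_inf[of "{a 0..\<alpha>}" "\<lambda>x. f x - x"] a_le[of 0] by auto
    define c where "c = f x0 - x0"
    have c: "c > 0" using mv x0(1) by (simp add: c_def)
    have inc: "a (Suc n) \<ge> a n + c" for n
    proof -
      have "a (Suc n) \<in> {a (Suc n)..b (Suc n)}" using ab(2)[of "Suc n"] by auto
      then obtain x where x: "x \<in> {a n..b n}" "a (Suc n) = f x" using pre by blast
      have "a 0 \<le> a n" by (rule lift_Suc_mono_le) (use a_mono less_imp_le in auto)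
      moreover have "x \<le> \<alpha>" using right'[OF x(1)] x(2) a_le[of "Suc n"] by simp
      ultimately show ?thesis using x x0(2)[of x] by (auto simp: c_def)
    qed
    have lin: "a n \<ge> a 0 + n * c" for n
    proof (induction n)
      case (Suc n)
      then show ?case using inc[of n] by (simp add: algebra_simps)
    qed simp
    obtain n :: nat where "n * c > 1" using reals_Archimedean3[OF c] by blast
    then show False using lin[of n] unit[of 0] unit[of n] ab(2)[of n] by linarith
  qed
  obtain d where d: "d > 0" "\<forall>N. \<exists>n\<ge>N. \<exists>x\<in>J. \<exists>y\<in>J. d \<le> \<bar>(f ^^ n) x - (f ^^ n) y\<bar>"
    using sep[OF J] by blast
  have "\<forall>\<^sub>F n in sequentially. \<alpha> - d < a n"
    using lim_a d(1) by (intro order_tendstoD) (auto simp: \<alpha>_def)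
  then obtain N where N: "\<And>n. n \<ge> N \<Longrightarrow> \<alpha> - d < a n" unfolding eventually_sequentially by blast
  obtain n x y where n: "n \<ge> N" "x \<in> J" "y \<in> J" "d \<le> \<bar>(f ^^ n) x - (f ^^ n) y\<bar>" using d(2) by blast
  have "(f ^^ n) x \<in> {a n..b n}" "(f ^^ n) y \<in> {a n..b n}" using n ab(1) by blast+
  then show False using N[OF n(1)] n(4) b_le[of n] \<open>\<alpha> = \<beta>\<close> by auto
qed

text \<open>Not every point swept out moves right, and by reflection not every one moves left. J
  meets f J, so the union of all images is connected and f x - x vanishes somewhere on it.\<close>

lemma swept_fixed_point:
  assumes J: "J \<in> ivls" and meet: "J \<inter> f ` J \<noteq> {}"
  shows "\<exists>n. \<exists>x\<in>(f ^^ n) ` J. f x = x"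
proof -
  obtain n x where x: "x \<in> (f ^^ n) ` J" "f x \<le> x"
    using not_all_moved_right[OF J meet] by blast
  interpret m: spreading_map "mirror f" by (rule spreading_map_mirror) (rule spreading_map_axioms)
  let ?r = "\<lambda>x::real. 1 - x"
  have "mirror f ` ?r ` J = ?r ` f ` J" using mirror_image[where n=1] by simp
  then have "?r ` J \<inter> mirror f ` ?r ` J \<noteq> {}" using meet by auto
  from m.not_all_moved_right[OF mirror_ivls[OF J] this]
  obtain m y where y: "y \<in> (f ^^ m) ` J" "f y \<ge> y"
    unfolding mirror_image by (auto simp: mirror_def)
  define U where "U = (\<Union>n. (f ^^ n) ` J)"
  have U: "(f ^^ n) ` J \<subseteq> U" for n unfolding U_def by blast
  have "connected U"
  proof -
    have "connected (\<Union>n\<le>N. (f ^^ n) ` J)" for N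
    proof (induction N)
      case 0
      then show ?case using J by (auto simp: ivls_def)
    next
      case (Suc N)
      have "(f ^^ N) ` (J \<inter> f ` J) \<subseteq> (f ^^ N) ` J \<inter> (f ^^ Suc N) ` J"
        by (auto simp: image_comp[symmetric] funpow_swap1)
      then have "(\<Union>n\<le>N. (f ^^ n) ` J) \<inter> (f ^^ Suc N) ` J \<noteq> {}" using meet by blast
      moreover have "connected ((f ^^ Suc N) ` J)"
        using ivlsE[OF image_ivls[OF J, of "Suc N"]] by (metis connected_Icc)
      ultimately show ?case using connected_Un[OF Suc] by (simp add: atMost_Suc Un_commute)
    qed
    then have "connected (\<Union>N. \<Union>n\<le>N. (f ^^ n) ` J)"
    proof (intro connected_Union)
      obtain x where "x \<in> J" using ivls_nonempty[OF J] by blast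
      then have "x \<in> (\<Union>n\<le>N. (f ^^ n) ` J)" for N by (intro UN_I[of 0]) auto
      then show "(\<Inter>N. \<Union>n\<le>N. (f ^^ n) ` J) \<noteq> {}" by blast
    qed blast
    moreover have "U = (\<Union>N. \<Union>n\<le>N. (f ^^ n) ` J)" unfolding U_def by blast
    ultimately show ?thesis by simp
  qed
  moreover have "continuous_on U (\<lambda>x. f x - x)"
    using funpow_image_subset ivls_subset[OF J] unfolding U_def
    by (intro continuous_intros continuous_on_subset[OF cont]) blast
  ultimately have "connected ((\<lambda>x. f x - x) ` U)" using connected_continuous_image by blast
  moreover have "f x - x \<in> (\<lambda>x. f x - x) ` U" "f y - y \<in> (\<lambda>x. f x - x) ` U" using x y U by blast+
  ultimately have "0 \<in> (\<lambda>x. f x - x) ` U"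
    using x(2) y(2) connectedD_interval[of "(\<lambda>x. f x - x) ` U" "f x - x" "f y - y" 0] by simp
  then obtain z where "z \<in> U" "f z = z" by auto
  then show ?thesis unfolding U_def by blast
qed

text \<open>By recurrence f^n J meets its own image under f^k, which is what the fixed point lemma
  needs for the k-th iterate.\<close>

lemma image_contains_periodic_point:
  assumes J: "J \<in> ivls"
  obtains n k z where "k \<ge> 1" "z \<in> (f ^^ n) ` J" "(f ^^ k) z = z"
proof -
  obtain n k where nk: "k \<ge> 1" "(f ^^ n) ` J \<inter> (f ^^ (n + k)) ` J \<noteq> {}"
    by (rule returning_interval[OF J])
  interpret g: spreading_map "f ^^ k" by (rule spreading_map_iterate[OF spreading_map_axioms nk(1)])
  have "(f ^^ n) ` J \<inter> (f ^^ k) ` (f ^^ n) ` J \<noteq> {}"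
    using nk(2) unfolding add.commute[of n k] funpow_image_add .
  then obtain m z where "z \<in> ((f ^^ k) ^^ m) ` (f ^^ n) ` J" "(f ^^ k) z = z"
    using g.swept_fixed_point[OF image_ivls[OF J, of n]] by metis
  then show thesis using that[OF nk(1), of z "k * m + n"]
    unfolding funpow_mult funpow_image_add by blast
qed

end

text \<open>A nondegenerate common part is demanded because it can serve as an interval in turn; a
  single common point cannot. Both images are taken at the same time.\<close>

definition ev_overlap :: "(real \<Rightarrow> real) \<Rightarrow> real set \<Rightarrow> real set \<Rightarrow> bool" where
  "ev_overlap f J L \<longleftrightarrow> (\<exists>n. \<exists>K\<in>ivls. K \<subseteq> (f ^^ n) ` J \<inter> (f ^^ n) ` L)"

lemma ev_overlap_sym: "ev_overlap f J L \<longleftrightarrow> ev_overlap f L J"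
  by (auto simp: ev_overlap_def)

lemma ev_overlap_mono: "ev_overlap f J L \<Longrightarrow> J \<subseteq> J' \<Longrightarrow> L \<subseteq> L' \<Longrightarrow> ev_overlap f J' L'"
  unfolding ev_overlap_def by (meson Int_mono image_mono subset_trans)

lemma ev_overlap_image:
  assumes "ev_overlap f ((f ^^ m) ` J) ((f ^^ m) ` L)"
  shows "ev_overlap f J L"
proof -
  obtain n K where "K \<in> ivls" "K \<subseteq> (f ^^ (n + m)) ` J \<inter> (f ^^ (n + m)) ` L"
    using assms unfolding ev_overlap_def by (auto simp: funpow_add image_comp)
  then show ?thesis unfolding ev_overlap_def by blast
qed

lemma ev_overlap_iterate: "ev_overlap (f ^^ k) J L \<Longrightarrow> ev_overlap f J L"
  unfolding ev_overlap_def funpow_mult by blast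

lemma mirror_mirror_image: "(\<lambda>x::real. 1 - x) ` (\<lambda>x. 1 - x) ` J = J"
  by (simp add: image_comp)

lemma ev_overlap_mirror:
  assumes "ev_overlap (mirror f) ((\<lambda>x. 1 - x) ` J) ((\<lambda>x. 1 - x) ` L)"
  shows "ev_overlap f J L"
proof -
  let ?r = "\<lambda>x::real. 1 - x"
  obtain n K where K: "K \<in> ivls" "K \<subseteq> ?r ` (f ^^ n) ` J \<inter> ?r ` (f ^^ n) ` L"
    using assms unfolding ev_overlap_def mirror_image by blast
  then have "?r ` K \<subseteq> ?r ` ?r ` (f ^^ n) ` J \<inter> ?r ` ?r ` (f ^^ n) ` L" by blast
  then have "?r ` K \<subseteq> (f ^^ n) ` J \<inter> (f ^^ n) ` L" unfolding mirror_mirror_image .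
  then show ?thesis using mirror_ivls[OF K(1)] unfolding ev_overlap_def by blast
qed

text \<open>Iterating the inequality a full period turns it around.\<close>

lemma periodic_shift_eq:
  fixes w :: "nat \<Rightarrow> real"
  assumes per: "\<And>s. w (s + k) = w s" and k: "k \<ge> 1"
    and le: "\<And>s. w (s + m) \<le> w (s + n)"
  shows "w (s + m) = w (s + n)"
proof -
  have it: "w (s + j * m) \<le> w (s + j * n)" for s j
  proof (induction j arbitrary: s)
    case (Suc j)
    have "w (s + Suc j * m) = w ((s + j * m) + m)" by (simp add: algebra_simps)
    also have "\<dots> \<le> w ((s + n) + j * m)" using le[of "s + j * m"] by (simp add: algebra_simps)
    also have "\<dots> \<le> w ((s + n) + j * n)" by (rule Suc)
    finally show ?case by (simp add: algebra_simps)
  qed simp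
  have per': "w (s + j * k) = w s" for s j
  proof (induction j)
    case (Suc j)
    have "w (s + Suc j * k) = w ((s + j * k) + k)" by (simp add: algebra_simps)
    then show ?case using per[of "s + j * k"] Suc by simp
  qed simp
  obtain j where j: "k = Suc j" using k by (cases k) auto
  \<comment> \<open>The shift m * k consists of k copies of m. One is kept, the other j = k - 1 are
    replaced by n, and with the n already there they make the full shift n * k.\<close>
  have "w (s + n) = w (s + n + m * k)" by (rule per'[symmetric])
  also have "\<dots> = w ((s + n + m) + j * m)" by (simp add: j algebra_simps)
  also have "\<dots> \<le> w ((s + n + m) + j * n)" by (rule it)
  also have "\<dots> = w (s + m + n * k)" by (simp add: j algebra_simps)
  also have "\<dots> = w (s + m)" by (rule per')
  finally show ?thesis using le[of s] by simp
qed

section \<open>Intervals that contain fixed points and never overlap\<close>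

context spreading_map
begin

lemma ev_overlapI:
  "J \<in> ivls \<Longrightarrow> L \<in> ivls \<Longrightarrow> x \<in> (f ^^ n) ` J \<Longrightarrow> y \<in> (f ^^ n) ` J \<Longrightarrow>
    x \<in> (f ^^ n) ` L \<Longrightarrow> y \<in> (f ^^ n) ` L \<Longrightarrow> x < y \<Longrightarrow> ev_overlap f J L"
  using ivls_Int[of "(f ^^ n) ` J" "(f ^^ n) ` L" x y] unfolding ev_overlap_def by (metis image_ivls)

lemma fixed_in_image:
  assumes "p \<in> J" "f p = p"
  shows "p \<in> (f ^^ n) ` J"
proof -
  have "(f ^^ n) p = p" by (induction n) (use assms(2) in auto)
  then show ?thesis using assms(1) by (metis imageI)
qed

context
  fixes J L p q
  assumes J: "J \<in> ivls" and L: "L \<in> ivls" and p: "p \<in> J" "f p = p" and q: "q \<in> L" "f q = q"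
    and pq: "p < q" and novl: "\<not> ev_overlap f J L"
begin

text \<open>A point y < p together with q would make p an inner point of the image of L; the image
  of J at that time contains p as well and is nondegenerate, so the two would overlap.\<close>

lemma image_lower_bound: "p \<le> y" if y: "y \<in> (f ^^ n) ` L"
proof (rule ccontr)
  assume "\<not> ?thesis"
  then have "y < p" by simp
  then show False
    using ivls_Int_nbhd[OF image_ivls[OF J] image_ivls[OF L] fixed_in_image[OF p] y fixed_in_image[OF q]]
      pq novl unfolding ev_overlap_def by blast
qed

lemma image_upper_bound: "x \<le> q" if x: "x \<in> (f ^^ n) ` J"
proof (rule ccontr)
  assume "\<not> ?thesis"
  then have "q < x" by simp
  then show False
    using ivls_Int_nbhd[OF image_ivls[OF L] image_ivls[OF J] fixed_in_image[OF q] fixed_in_image[OF p] x]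
      pq novl unfolding ev_overlap_def by blast
qed

text \<open>The image of J contains the segment from p to x, that of L the segment from y to q, and
  by the two bounds both contain [y,x]. The times n and m may differ, so this is not yet an overlap
  in the sense of \<open>ev_overlap\<close>.\<close>

lemma image_crossing:
  assumes x: "x \<in> (f ^^ n) ` J" and y: "y \<in> (f ^^ m) ` L" and "y < x"
  shows "\<exists>K\<in>ivls. K \<subseteq> (f ^^ n) ` J \<inter> (f ^^ m) ` L"
proof (rule ivls_Int[OF image_ivls[OF J] image_ivls[OF L] _ x y _ \<open>y < x\<close>])
  show "y \<in> (f ^^ n) ` J"
    using ivls_between[OF image_ivls[OF J] fixed_in_image[OF p] x] image_lower_bound[OF y] assms(3) by simp
  show "x \<in> (f ^^ m) ` L"
    using ivls_between[OF image_ivls[OF L] y fixed_in_image[OF q]] image_upper_bound[OF x] assms(3) by simp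
qed

lemma image_le_same_time:
  assumes "x \<in> (f ^^ n) ` J" "y \<in> (f ^^ n) ` L"
  shows "x \<le> y"
  using image_crossing[OF assms] novl unfolding ev_overlap_def by (meson not_le)

text \<open>An overlap at different times would contain a periodic point later on, whose orbit pins the
  images of both intervals to opposite sides of it.\<close>

lemma image_le:
  assumes x: "x \<in> (f ^^ n) ` J" and y: "y \<in> (f ^^ m) ` L"
  shows "x \<le> y"
proof (rule ccontr)
  assume "\<not> ?thesis"
  then obtain K where K: "K \<in> ivls" "K \<subseteq> (f ^^ n) ` J \<inter> (f ^^ m) ` L"
    using image_crossing[OF x y] by auto
  obtain i k w where w: "k \<ge> 1" "w \<in> (f ^^ i) ` K" "(f ^^ k) w = w"
    by (rule image_contains_periodic_point[OF K(1)])
  define W where "W = (\<lambda>s. (f ^^ s) w)"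
  have mem: "W s \<in> (f ^^ (s + i)) ` K" for s
    unfolding W_def funpow_image_add using w(2) by blast
  have KJ: "(f ^^ s) ` K \<subseteq> (f ^^ (s + n)) ` J" and KL: "(f ^^ s) ` K \<subseteq> (f ^^ (s + m)) ` L" for s
    unfolding funpow_image_add using K(2) by blast+
  have WJ: "W s \<in> (f ^^ (s + i + n)) ` J" and WL: "W s \<in> (f ^^ (s + i + m)) ` L" for s
    using mem KJ KL by blast+
  have "W (s + k) = W s" for s unfolding W_def funpow_add comp_apply w(3) ..
  \<comment> \<open>Both points are seen at the common time s + m + i + n: the first in the image of
    J, the second in that of L.\<close>
  moreover have "W (s + m) \<le> W (s + n)" for s
    using image_le_same_time[of _ "s + m + i + n"] WJ[of "s + m"] WL[of "s + n"]
    by (simp add: ac_simps)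
  ultimately have eq: "W (s + m) = W (s + n)" for s using periodic_shift_eq w(1) by blast
  \<comment> \<open>Comparison at common times squeezes v between W (m + m) and W (n + n), which by
    \<open>eq\<close> both equal W (n + m).\<close>
  have "v = W (n + m)" if v: "v \<in> (f ^^ (n + m + i)) ` K" for v
  proof -
    have "v \<le> W (n + n)"
      using image_le_same_time[of v "n + m + i + n" "W (n + n)"] KJ[of "n + m + i"] v WL[of "n + n"]
      by (auto simp: ac_simps)
    moreover have "W (m + m) \<le> v"
      using image_le_same_time[of "W (m + m)" "n + m + i + m" v] KL[of "n + m + i"] v WJ[of "m + m"]
      by (auto simp: ac_simps)
    ultimately show ?thesis using eq[of n] eq[of m] by (simp add: add.commute)
  qed
  moreover obtain u v where "u \<in> (f ^^ (n + m + i)) ` K" "v \<in> (f ^^ (n + m + i)) ` K" "u < v"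
    by (rule ivls_two_points[OF image_ivls[OF K(1)]])
  ultimately show False by (metis less_irrefl)
qed

end

end

section \<open>Of three intervals, two overlap eventually\<close>

context spreading_map
begin

lemma ev_overlap_at_common_point:
  assumes J: "J \<in> ivls" and L: "L \<in> ivls"
    and z: "z \<in> (f ^^ n) ` J" "z \<in> (f ^^ n) ` L" and xy: "x \<in> (f ^^ n) ` J" "y \<in> (f ^^ n) ` L"
    and side: "z < x \<and> z < y \<or> x < z \<and> y < z"
  shows "ev_overlap f J L"
  using side
proof
  assume *: "z < x \<and> z < y"
  have "min x y \<in> (f ^^ n) ` J" "min x y \<in> (f ^^ n) ` L"
    using ivls_between[OF image_ivls[OF J] z(1) xy(1)] ivls_between[OF image_ivls[OF L] z(2) xy(2)] *
    by auto
  then show ?thesis using ev_overlapI[OF J L z(1) _ z(2)] * by simp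
next
  assume *: "x < z \<and> y < z"
  have "max x y \<in> (f ^^ n) ` J" "max x y \<in> (f ^^ n) ` L"
    using ivls_between[OF image_ivls[OF J] xy(1) z(1)] ivls_between[OF image_ivls[OF L] xy(2) z(2)] *
    by auto
  then show ?thesis using ev_overlapI[OF J L _ z(1) _ z(2)] * by simp
qed

text \<open>With z1 < z2, order keeps J2 between all images of J1 and all images of J3, against
  proximality. With z1 = z2 there is no such order: J1 and J2 contain the same fixed point at all
  times, on opposite sides of it. The one that starts on the right never changes sides, so the other
  stays on the left, at distance at least e - z from the images of J3.\<close>

lemma three_intervals_ordered:
  assumes J: "J1 \<in> ivls" "J2 \<in> ivls" "J3 \<in> ivls"
    and z: "z1 \<in> J1" "f z1 = z1" "z2 \<in> J2" "f z2 = z2" "z3 \<in> J3" "f z3 = z3"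
    and ord: "z1 \<le> z2" "z2 < z3"
  shows "ev_overlap f J1 J2 \<or> ev_overlap f J1 J3 \<or> ev_overlap f J2 J3"
proof (rule ccontr)
  assume "\<not> ?thesis"
  then have novl: "\<not> ev_overlap f J1 J2" "\<not> ev_overlap f J1 J3" "\<not> ev_overlap f J2 J3" by auto
  have z13: "z1 < z3" using ord by simp
  \<comment> \<open>Since J3 has the rightmost fixed point, e separates its images from those of J1
    and J2 at all times, even at different ones.\<close>
  define e where "e = Inf (\<Union>n. (f ^^ n) ` J3)"
  have ne: "(\<Union>n. (f ^^ n) ` J3) \<noteq> {}" using ivls_nonempty[OF J(3)] by auto
  have "(f ^^ n) ` J3 \<subseteq> {0..1}" for n by (rule funpow_image_subset[OF ivls_subset[OF J(3)]])
  then have "(\<Union>n. (f ^^ n) ` J3) \<subseteq> {0..1}" by (rule UN_least)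
  then have "bdd_below (\<Union>n. (f ^^ n) ` J3)" by (rule bdd_below_mono[rotated]) simp
  then have e_le: "e \<le> y" if "y \<in> (f ^^ n) ` J3" for y n
    unfolding e_def using that by (intro cInf_lower) auto
  have le_e1: "x \<le> e" if "x \<in> (f ^^ n) ` J1" for x n
    unfolding e_def
    by (intro cInf_greatest[OF ne], elim UN_E)
      (rule image_le[OF J(1,3) z(1,2,5,6) z13 novl(2) that])
  have le_e2: "x \<le> e" if "x \<in> (f ^^ n) ` J2" for x n
    unfolding e_def
    by (intro cInf_greatest[OF ne], elim UN_E)
      (rule image_le[OF J(2,3) z(3,4,5,6) ord(2) novl(3) that])
  have near: "\<exists>n. \<exists>x\<in>(f ^^ n) ` J. \<exists>y\<in>(f ^^ n) ` J3. x \<le> e \<and> e \<le> y \<and> y - x < \<delta>"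
    if "J = J1 \<or> J = J2" and "\<delta> > 0" for J \<delta>
  proof -
    have "J \<in> ivls" using that J by auto
    then obtain n x y where n: "x \<in> J" "y \<in> J3" "\<bar>(f ^^ n) x - (f ^^ n) y\<bar> < \<delta>"
      using prox[OF _ J(3) \<open>\<delta> > 0\<close>] by blast
    moreover have "(f ^^ n) x \<le> e" using le_e1[of _ n] le_e2[of _ n] n(1) that(1) by blast
    moreover have "e \<le> (f ^^ n) y" using e_le[of _ n] n(2) by blast
    ultimately show ?thesis by (intro exI[of _ n] bexI[of _ "(f ^^ n) x"] bexI[of _ "(f ^^ n) y"]) auto
  qed
  show False
  proof (cases "z1 < z2")
    case True
    \<comment> \<open>At time 0 the interval J2 occupies [u,v] between everything coming from J1 and
      everything coming from J3, so these never get closer than v - u.\<close>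
    obtain u v where uv: "u \<in> J2" "v \<in> J2" "u < v" by (rule ivls_two_points[OF J(2)])
    then obtain n x y where n: "x \<in> (f ^^ n) ` J1" "e \<le> y" "y - x < v - u"
      using near[of J1 "v - u"] by auto
    have "x \<le> u" using image_le[OF J(1,2) z(1,2,3,4) True novl(1) n(1), of u 0] uv(1) by simp
    moreover have "v \<le> e" using le_e2[of v 0] uv(2) by simp
    ultimately show False using n uv(3) by linarith
  next
    case False
    then have z12: "z1 = z2" using ord by simp
    define z where "z = z2"
    define R where "R = (\<lambda>J n. \<forall>x\<in>(f ^^ n) ` J. z \<le> x)"
    define Lf where "Lf = (\<lambda>J n. \<forall>x\<in>(f ^^ n) ` J. x \<le> z)"
    have zin: "z \<in> (f ^^ n) ` J" if "J = J1 \<or> J = J2" for J n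
      using that fixed_in_image[OF z(1,2)] fixed_in_image[OF z(3,4)] z12 unfolding z_def by auto
    have Jiv: "(f ^^ n) ` J \<in> ivls" if "J = J1 \<or> J = J2" for J n using that J by auto
    have le_e: "x \<le> e" if "J = J1 \<or> J = J2" "x \<in> (f ^^ n) ` J" for J x n
      using that le_e1 le_e2 by blast
    have nonsing: "\<not> (R J n \<and> Lf J n)" if Jc: "J = J1 \<or> J = J2" for J n
    proof -
      obtain u v where "u \<in> (f ^^ n) ` J" "v \<in> (f ^^ n) ` J" "u < v"
        by (rule ivls_two_points[OF Jiv[OF Jc]])
      then show ?thesis unfolding R_def Lf_def by force
    qed
    have opp: "\<not> (z < x \<and> z < y \<or> x < z \<and> y < z)"
      if "x \<in> (f ^^ n) ` J1" "y \<in> (f ^^ n) ` J2" for x y n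
      using ev_overlap_at_common_point[OF J(1,2) zin zin that] novl(1) by blast
    \<comment> \<open>Images sharing z and reaching to the same side of it would overlap; so at each
      time one of J1, J2 lies right of z and the other left.\<close>
    have side: "Lf J1 n \<and> R J2 n \<or> R J1 n \<and> Lf J2 n" for n
      using opp[of _ n] nonsing[of J1 n] nonsing[of J2 n] unfolding R_def Lf_def by (meson not_le)
    have one_sided: "R J n \<or> Lf J n" if "J = J1 \<or> J = J2" for J n
      using that side[of n] by blast
    have "z < e"
    proof -
      obtain J where "R J 0" "J = J1 \<or> J = J2" using side[of 0] by blast
      moreover from this have "\<not> Lf J 0" using nonsing[of J 0] by blast
      then obtain x where "x \<in> (f ^^ 0) ` J" "x > z" unfolding Lf_def by (meson not_le)
      ultimately show ?thesis using le_e[of J x 0] by linarith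
    qed
    have e01: "e \<in> {0..1}"
    proof -
      have "z3 \<in> {0..1}" "z \<in> {0..1}" using z ivls_subset J unfolding z_def by blast+
      then show ?thesis using e_le[of z3 0] z(5) \<open>z < e\<close> by auto
    qed
    have unit: "x \<in> {0..1}" if "x \<in> (f ^^ n) ` J" "J = J1 \<or> J = J2 \<or> J = J3" for x n J
    proof -
      have "J \<subseteq> {0..1}" using that(2) J ivls_subset by blast
      then show ?thesis using funpow_image_subset that(1) by blast
    qed
    have cont_e: "\<exists>\<delta>>0. \<forall>x\<in>{0..1}. \<bar>x - e\<bar> < \<delta> \<longrightarrow> \<bar>f x - f e\<bar> < \<eta>" if "\<eta> > 0" for \<eta>
      using cont e01 that unfolding continuous_on_iff dist_real_def by blast
    \<comment> \<open>J1 and J3 come arbitrarily close to e from its two sides, at a common time. If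
      f moved e, both would be on the same side of e one step later.\<close>
    have "f e = e"
    proof (rule ccontr)
      assume "f e \<noteq> e"
      then obtain \<delta> where \<delta>: "\<delta> > 0"
        "\<And>x. x \<in> {0..1} \<Longrightarrow> \<bar>x - e\<bar> < \<delta> \<Longrightarrow> \<bar>f x - f e\<bar> < \<bar>f e - e\<bar>"
        using cont_e[of "\<bar>f e - e\<bar>"] by auto
      obtain n x y where n: "x \<in> (f ^^ n) ` J1" "y \<in> (f ^^ n) ` J3" "x \<le> e" "e \<le> y" "y - x < \<delta>"
        using near[OF _ \<delta>(1), of J1] by blast
      have "f x \<in> (f ^^ Suc n) ` J1" "f y \<in> (f ^^ Suc n) ` J3"
        unfolding funpow_image_Suc using n by blast+
      then have "f x \<le> e" "e \<le> f y" using le_e1 e_le by blast+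
      moreover have "\<bar>f x - f e\<bar> < \<bar>f e - e\<bar>" "\<bar>f y - f e\<bar> < \<bar>f e - e\<bar>"
        using \<delta>(2) unit n by auto
      ultimately show False by linarith
    qed
    then obtain \<delta> where \<delta>: "\<delta> > 0" "\<And>x. x \<in> {0..1} \<Longrightarrow> \<bar>x - e\<bar> < \<delta> \<Longrightarrow> z < f x"
      using cont_e[of "e - z"] \<open>z < e\<close> by force
    have stays: "R J (Suc n)" if Jc: "J = J1 \<or> J = J2" and "R J n" for J n
    proof (rule ccontr)
      assume "\<not> R J (Suc n)"
      then have left: "Lf J (Suc n)" using one_sided[OF Jc] by blast
      obtain a b where ab: "(f ^^ n) ` J = {a..b}" "a < b" by (rule ivlsE[OF Jiv[OF Jc]])
      then have "a = z" using \<open>R J n\<close> zin[OF Jc, of n] unfolding R_def by force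
      have "f b \<in> (f ^^ Suc n) ` J" unfolding funpow_image_Suc ab using ab(2) by auto
      then have "f b \<le> z" using left unfolding Lf_def by blast
      then have "b \<noteq> e" using \<open>f e = e\<close> \<open>z < e\<close> by auto
      moreover have "b \<le> e" using le_e[OF Jc, of b n] ab by auto
      ultimately have "b < e" by simp
      \<comment> \<open>This image of J reaches closer to e than b, hence contains [z,b]; near the
        fixed point e its point x is still mapped to the right of z. So its next image lies on the
        right, and it contains f^(n+1) J.\<close>
      then obtain m x y where m: "x \<in> (f ^^ m) ` J" "x \<le> e" "e \<le> y" "y - x < min \<delta> (e - b)"
        using near[OF Jc, of "min \<delta> (e - b)"] \<delta>(1) by auto
      have x: "b < x" "z < f x" using m \<delta>(2)[of x] unit[of x m J] Jc by auto
      have "{a..b} \<subseteq> (f ^^ m) ` J"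
        using ivls_between[OF Jiv[OF Jc] zin[OF Jc] m(1)] x(1) \<open>a = z\<close> by auto
      then have "(f ^^ Suc n) ` J \<subseteq> (f ^^ Suc m) ` J" unfolding funpow_image_Suc ab(1) by blast
      moreover have "f x \<in> (f ^^ Suc m) ` J" unfolding funpow_image_Suc using m(1) by blast
      ultimately have "R J (Suc m)" using one_sided[OF Jc, of "Suc m"] x(2) unfolding Lf_def by force
      then have "R J (Suc n)" using \<open>(f ^^ Suc n) ` J \<subseteq> (f ^^ Suc m) ` J\<close> unfolding R_def by blast
      then show False using \<open>\<not> R J (Suc n)\<close> by blast
    qed
    obtain J J' where JJ': "{J, J'} = {J1, J2}" "R J 0" using side[of 0] by blast
    then have Jc: "J = J1 \<or> J = J2" "J' = J1 \<or> J' = J2" by blast+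
    have "R J n" for n by (induction n) (use JJ'(2) stays[OF Jc(1)] in auto)
    then have "Lf J' n" for n using nonsing[OF Jc(1), of n] side[of n] JJ'(1) by (auto simp: doubleton_eq_iff)
    moreover obtain n x y where "x \<in> (f ^^ n) ` J'" "e \<le> y" "y - x < e - z"
      using near[OF Jc(2), of "e - z"] \<open>z < e\<close> by auto
    ultimately have "x \<le> z" unfolding Lf_def by blast
    then show False using \<open>e \<le> y\<close> \<open>y - x < e - z\<close> by linarith
  qed
qed

text \<open>The case z1 < z2 reduces to the other strict case by reflection. If all three fixed
  points coincide, two of the intervals reach to the same side of that point already at time
  0.\<close>

lemma three_intervals_sorted:
  assumes J: "J1 \<in> ivls" "J2 \<in> ivls" "J3 \<in> ivls"
    and z: "z1 \<in> J1" "f z1 = z1" "z2 \<in> J2" "f z2 = z2" "z3 \<in> J3" "f z3 = z3"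
    and ord: "z1 \<le> z2" "z2 \<le> z3"
  shows "ev_overlap f J1 J2 \<or> ev_overlap f J1 J3 \<or> ev_overlap f J2 J3"
proof -
  consider "z2 < z3" | "z1 < z2" | "z1 = z2" "z2 = z3" using ord by linarith
  then show ?thesis
  proof cases
    case 1
    then show ?thesis using three_intervals_ordered[OF J z ord(1)] by blast
  next
    case 2
    let ?r = "\<lambda>x::real. 1 - x"
    interpret m: spreading_map "mirror f" by (rule spreading_map_mirror) (rule spreading_map_axioms)
    have "ev_overlap (mirror f) (?r ` J3) (?r ` J2) \<or> ev_overlap (mirror f) (?r ` J3) (?r ` J1) \<or>
        ev_overlap (mirror f) (?r ` J2) (?r ` J1)"
      by (rule m.three_intervals_ordered[of _ _ _ "1 - z3" "1 - z2" "1 - z1"])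
        (use mirror_ivls J z ord 2 in \<open>auto simp: mirror_def\<close>)
    then show ?thesis using ev_overlap_mirror ev_overlap_sym by blast
  next
    case 3
    have ov: "ev_overlap f J L"
      if "J \<in> ivls" "L \<in> ivls" "z1 \<in> J" "z1 \<in> L" "x \<in> J" "y \<in> L"
        "z1 < x \<and> z1 < y \<or> x < z1 \<and> y < z1" for J L x y
      using ev_overlap_at_common_point[of J L z1 0 x y] that by simp
    have "\<exists>x\<in>J. x \<noteq> z1" if "J \<in> ivls" for J
      using ivls_two_points[OF that] by (metis less_irrefl)
    then obtain x1 x2 x3 where "x1 \<in> J1" "x2 \<in> J2" "x3 \<in> J3" "x1 \<noteq> z1" "x2 \<noteq> z1" "x3 \<noteq> z1"
      using J by meson
    then show ?thesis
      using ov[of J1 J2 x1 x2] ov[of J1 J3 x1 x3] ov[of J2 J3 x2 x3] J z 3 by (auto simp: neq_iff)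
  qed
qed

lemma three_intervals_fixed:
  assumes J: "J1 \<in> ivls" "J2 \<in> ivls" "J3 \<in> ivls"
    and z: "z1 \<in> J1" "f z1 = z1" "z2 \<in> J2" "f z2 = z2" "z3 \<in> J3" "f z3 = z3"
  shows "ev_overlap f J1 J2 \<or> ev_overlap f J1 J3 \<or> ev_overlap f J2 J3"
proof -
  consider "z1 \<le> z2" "z2 \<le> z3" | "z1 \<le> z3" "z3 \<le> z2" | "z2 \<le> z1" "z1 \<le> z3"
    | "z2 \<le> z3" "z3 \<le> z1" | "z3 \<le> z1" "z1 \<le> z2" | "z3 \<le> z2" "z2 \<le> z1"
    by linarith
  then show ?thesis
    by cases (use three_intervals_sorted J z ev_overlap_sym in metis)+
qed

text \<open>A common time n and a common multiple k of the periods turn the periodic points into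
  fixed points of f^k in the images at time n. An overlap of these images under f^k is an overlap of
  the original intervals under f.\<close>

theorem three_intervals:
  assumes J: "J1 \<in> ivls" "J2 \<in> ivls" "J3 \<in> ivls"
  shows "ev_overlap f J1 J2 \<or> ev_overlap f J1 J3 \<or> ev_overlap f J2 J3"
proof -
  obtain n1 k1 z1 where 1: "k1 \<ge> 1" "z1 \<in> (f ^^ n1) ` J1" "(f ^^ k1) z1 = z1"
    by (rule image_contains_periodic_point[OF J(1)])
  obtain n2 k2 z2 where 2: "k2 \<ge> 1" "z2 \<in> (f ^^ n2) ` J2" "(f ^^ k2) z2 = z2"
    by (rule image_contains_periodic_point[OF J(2)])
  obtain n3 k3 z3 where 3: "k3 \<ge> 1" "z3 \<in> (f ^^ n3) ` J3" "(f ^^ k3) z3 = z3"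
    by (rule image_contains_periodic_point[OF J(3)])
  define k where "k = k1 * k2 * k3"
  have "k \<ge> 1" using 1 2 3 by (simp add: k_def)
  define n where "n = n1 + n2 + n3"
  have per: "\<exists>z\<in>(f ^^ n) ` J. (f ^^ k) z = z"
    if z: "z \<in> (f ^^ m) ` J" "(f ^^ l) z = z" "l dvd k" "m \<le> n" for J l m z
  proof
    show "(f ^^ (n - m)) z \<in> (f ^^ n) ` J"
      using z(1,4) funpow_image_add[of "n - m" m] by auto
    obtain q where "k = l * q" using z(3) by (rule dvdE)
    moreover have "((f ^^ l) ^^ q) z = z" by (induction q) (use z(2) in auto)
    ultimately have "(f ^^ k) z = z" by (simp add: funpow_mult)
    then show "(f ^^ k) ((f ^^ (n - m)) z) = (f ^^ (n - m)) z"
      by (metis add.commute comp_apply funpow_add)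
  qed
  interpret g: spreading_map "f ^^ k"
    by (rule spreading_map_iterate[OF spreading_map_axioms \<open>k \<ge> 1\<close>])
  obtain y1 where "y1 \<in> (f ^^ n) ` J1" "(f ^^ k) y1 = y1"
    using per[OF 1(2,3)] by (auto simp: k_def n_def)
  moreover obtain y2 where "y2 \<in> (f ^^ n) ` J2" "(f ^^ k) y2 = y2"
    using per[OF 2(2,3)] by (auto simp: k_def n_def)
  moreover obtain y3 where "y3 \<in> (f ^^ n) ` J3" "(f ^^ k) y3 = y3"
    using per[OF 3(2,3)] by (auto simp: k_def n_def)
  ultimately show ?thesis
    using g.three_intervals_fixed[OF J[THEN image_ivls[of _ n]]] ev_overlap_iterate ev_overlap_image
    by metis
qed

section \<open>Clusters of finite families and the spread of images\<close>

lemma finite_cluster: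
  assumes "finite \<J>" "\<J> \<subseteq> ivls" "J0 \<in> \<J>"
  obtains n L1 L2 where "L1 \<in> ivls" "L2 \<in> ivls" "L1 \<subseteq> (f ^^ n) ` J0"
    "\<And>J. J \<in> \<J> \<Longrightarrow> L1 \<subseteq> (f ^^ n) ` J \<or> L2 \<subseteq> (f ^^ n) ` J"
proof -
  have "\<exists>n. \<exists>L1\<in>ivls. \<exists>L2\<in>ivls. \<forall>J\<in>\<J>. L1 \<subseteq> (f ^^ n) ` J \<or> L2 \<subseteq> (f ^^ n) ` J"
    using assms(1,2)
  proof (induction \<J> rule: finite_induct)
    case empty
    have "{0..1} \<in> ivls" by (rule ivlsI) auto
    then show ?case by blast
  next
    case (insert L \<J>)
    then obtain n L1 L2 where L: "L1 \<in> ivls" "L2 \<in> ivls"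
      "\<And>J. J \<in> \<J> \<Longrightarrow> L1 \<subseteq> (f ^^ n) ` J \<or> L2 \<subseteq> (f ^^ n) ` J"
      by (metis insert_subset)
    define L3 where "L3 = (f ^^ n) ` L"
    have L3: "L3 \<in> ivls" using insert.prems by (simp add: L3_def)
    have im: "(f ^^ m) ` A \<subseteq> (f ^^ (m + n)) ` J" if "A \<subseteq> (f ^^ n) ` J" for m A J
      unfolding funpow_image_add using that by (rule image_mono)
    \<comment> \<open>The new interval makes three candidates. Two of them overlap at some time and
      are replaced by a common interval; the third is moved along to that time.\<close>
    have "\<exists>m. \<exists>K1\<in>ivls. \<exists>K2\<in>ivls. \<forall>A\<in>{L1, L2, L3}. K1 \<subseteq> (f ^^ m) ` A \<or> K2 \<subseteq> (f ^^ m) ` A"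
    proof -
      have pair: "\<exists>m. \<exists>K1\<in>ivls. \<exists>K2\<in>ivls. \<forall>A\<in>{X, Y, Z}. K1 \<subseteq> (f ^^ m) ` A \<or> K2 \<subseteq> (f ^^ m) ` A"
        if XY: "ev_overlap f X Y" and "Z \<in> ivls" for X Y Z
      proof -
        obtain m K where "K \<in> ivls" "K \<subseteq> (f ^^ m) ` X \<inter> (f ^^ m) ` Y"
          using XY unfolding ev_overlap_def by blast
        moreover have "(f ^^ m) ` Z \<in> ivls" using that(2) by simp
        ultimately show ?thesis
          by (intro exI[of _ m] bexI[of _ K] bexI[of _ "(f ^^ m) ` Z"]) simp_all
      qed
      consider "ev_overlap f L1 L2" | "ev_overlap f L1 L3" | "ev_overlap f L2 L3"
        using three_intervals[OF L(1,2) L3] by blast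
      then show ?thesis
      proof cases
        case 1
        show ?thesis using pair[OF 1 L3] .
      next
        case 2
        show ?thesis using pair[OF 2 L(2)] by (simp add: insert_commute)
      next
        case 3
        show ?thesis using pair[OF 3 L(1)] by (simp add: insert_commute)
      qed
    qed
    then obtain m K1 K2 where K: "K1 \<in> ivls" "K2 \<in> ivls"
      "\<And>A. A \<in> {L1, L2, L3} \<Longrightarrow> K1 \<subseteq> (f ^^ m) ` A \<or> K2 \<subseteq> (f ^^ m) ` A" by blast
    have "K1 \<subseteq> (f ^^ (m + n)) ` J \<or> K2 \<subseteq> (f ^^ (m + n)) ` J" if "J \<in> insert L \<J>" for J
    proof -
      have "L1 \<subseteq> (f ^^ n) ` J \<or> L2 \<subseteq> (f ^^ n) ` J \<or> L3 \<subseteq> (f ^^ n) ` J"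
        using that L(3)[of J] by (cases "J = L") (simp add: L3_def, blast)
      then obtain A where "A \<in> {L1, L2, L3}" "A \<subseteq> (f ^^ n) ` J" by (metis insertCI)
      then show ?thesis using K(3)[of A] im[of A J m] by (meson subset_trans)
    qed
    then show ?case
      by (intro exI[of _ "m + n"] bexI[OF _ K(1)] bexI[OF _ K(2)] ballI)
  qed
  then obtain n L1 L2 where L: "L1 \<in> ivls" "L2 \<in> ivls"
    "\<And>J. J \<in> \<J> \<Longrightarrow> L1 \<subseteq> (f ^^ n) ` J \<or> L2 \<subseteq> (f ^^ n) ` J" by blast
  \<comment> \<open>The interval lying in the image of J0 is named L1. Later J0 belongs to a point
    of the first of two finite sets, which thereby has a point in the cluster of L1.\<close>
  then consider "L1 \<subseteq> (f ^^ n) ` J0" | "L2 \<subseteq> (f ^^ n) ` J0" using assms(3) by blast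
  then show thesis
    by cases (use that[of L1 L2 n] that[of L2 L1 n] L in blast)+
qed

text \<open>A version of \<open>sep\<close> with an explicit constant, for arbitrary sets: in a
  finite union of intervals the distance may be realised only between different members.\<close>

definition spread :: "real \<Rightarrow> real set \<Rightarrow> bool" where
  "spread c J \<longleftrightarrow> (\<forall>N. \<exists>n\<ge>N. \<exists>x\<in>J. \<exists>y\<in>J. c \<le> \<bar>(f ^^ n) x - (f ^^ n) y\<bar>)"

lemma spread_mono: "spread c J \<Longrightarrow> J \<subseteq> J' \<Longrightarrow> c' \<le> c \<Longrightarrow> spread c' J'"
  unfolding spread_def by (meson order.trans subsetD)

lemma spread_image: "spread c ((f ^^ m) ` J) \<longleftrightarrow> spread c J"
proof
  assume *: "spread c ((f ^^ m) ` J)"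
  show "spread c J" unfolding spread_def
  proof
    fix N
    obtain n x y where "n \<ge> N" "x \<in> J" "y \<in> J" "c \<le> \<bar>(f ^^ n) ((f ^^ m) x) - (f ^^ n) ((f ^^ m) y)\<bar>"
      using * unfolding spread_def by blast
    then show "\<exists>n\<ge>N. \<exists>x\<in>J. \<exists>y\<in>J. c \<le> \<bar>(f ^^ n) x - (f ^^ n) y\<bar>"
      by (intro exI[of _ "n + m"]) (auto simp: funpow_add)
  qed
next
  assume *: "spread c J"
  show "spread c ((f ^^ m) ` J)" unfolding spread_def
  proof
    fix N
    obtain n x y where n: "n \<ge> N + m" "x \<in> J" "y \<in> J" "c \<le> \<bar>(f ^^ n) x - (f ^^ n) y\<bar>"
      using * unfolding spread_def by blast
    then have "(f ^^ n) z = (f ^^ (n - m)) ((f ^^ m) z)" for z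
      by (metis add_leD2 comp_apply funpow_add le_add_diff_inverse2)
    then show "\<exists>n\<ge>N. \<exists>x\<in>(f ^^ m) ` J. \<exists>y\<in>(f ^^ m) ` J. c \<le> \<bar>(f ^^ n) x - (f ^^ n) y\<bar>"
      using n by (intro exI[of _ "n - m"]) auto
  qed
qed

text \<open>\<open>hom\<close> speaks of subintervals of K only, whereas the common interval M found
  so far need not lie in K. So M is replaced by an interval S' inside one member whose image at time
  n lies in M; an overlap of S' with the new R at time p gives the common interval at time n +
  p.\<close>

lemma homogeneous_common_image:
  assumes hom: "\<And>R S. R \<in> ivls \<Longrightarrow> S \<in> ivls \<Longrightarrow> R \<subseteq> K \<Longrightarrow> S \<subseteq> K \<Longrightarrow> ev_overlap f R S"
    and fin: "finite \<R>" "\<R> \<noteq> {}" "\<R> \<subseteq> ivls" "\<Union>\<R> \<subseteq> K"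
  shows "\<exists>n. \<exists>M\<in>ivls. \<forall>R\<in>\<R>. M \<subseteq> (f ^^ n) ` R"
  using fin
proof (induction \<R> rule: finite_ne_induct)
  case (singleton R)
  then show ?case by (intro exI[of _ 0]) auto
next
  case (insert R \<R>)
  have "\<exists>n. \<exists>M\<in>ivls. \<forall>S\<in>\<R>. M \<subseteq> (f ^^ n) ` S" using insert.IH insert.prems by auto
  then obtain n M where M: "M \<in> ivls" "\<And>S. S \<in> \<R> \<Longrightarrow> M \<subseteq> (f ^^ n) ` S" by blast
  obtain S where S: "S \<in> \<R>" using insert.hyps by blast
  then have Sin: "S \<in> ivls" "S \<subseteq> K" using insert.prems by auto
  obtain S' where S': "S' \<in> ivls" "S' \<subseteq> S" "(f ^^ n) ` S' \<subseteq> M"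
    using ivls_preimage[OF Sin(1) M(1) M(2)[OF S]] by blast
  have "ev_overlap f S' R" using hom S' Sin insert.prems by auto
  then obtain p Q where Q: "Q \<in> ivls" "Q \<subseteq> (f ^^ p) ` S'" "Q \<subseteq> (f ^^ p) ` R"
    unfolding ev_overlap_def by blast
  have "(f ^^ n) ` Q \<subseteq> (f ^^ (n + p)) ` R"
    unfolding funpow_image_add using Q(3) by (rule image_mono)
  moreover have "(f ^^ n) ` Q \<subseteq> (f ^^ (n + p)) ` T" if "T \<in> \<R>" for T
  proof -
    have "(f ^^ n) ` Q \<subseteq> (f ^^ n) ` (f ^^ p) ` S'" using Q(2) by (rule image_mono)
    also have "\<dots> = (f ^^ p) ` (f ^^ n) ` S'" by (rule funpow_image_commute)
    also have "\<dots> \<subseteq> (f ^^ p) ` (f ^^ n) ` T"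
      by (rule image_mono[OF subset_trans[OF S'(3) M(2)[OF that]]])
    also have "\<dots> = (f ^^ (n + p)) ` T" unfolding funpow_image_add by (rule funpow_image_commute)
    finally show ?thesis .
  qed
  ultimately show ?case using Q(1) by (intro exI[of _ "n + p"] bexI[of _ "(f ^^ n) ` Q"]) auto
qed

text \<open>The set of intervals in this condition encodes a product of basic open sets in the
  hyperspace.\<close>

lemma uniform_spread:
  assumes H: "\<And>J. J \<in> ivls \<Longrightarrow> \<exists>\<delta>>0. \<exists>\<R>. finite \<R> \<and> \<R> \<noteq> {} \<and> \<R> \<subseteq> ivls \<and> \<Union>\<R> \<subseteq> J \<and>
      (\<forall>r. (\<forall>R\<in>\<R>. r R \<in> ivls \<and> r R \<subseteq> R) \<longrightarrow> spread (\<epsilon> + \<delta>) (\<Union>R\<in>\<R>. r R))"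
  obtains c where "c > \<epsilon>" "\<And>J. J \<in> ivls \<Longrightarrow> spread c J"
proof -
  \<comment> \<open>If all subintervals of K overlap eventually, the one family that
    \<open>H\<close> gives for K yields a constant for every J overlapping K.\<close>
  have hom_spread: "\<exists>\<delta>>0. \<forall>J\<in>ivls. ev_overlap f J K \<longrightarrow> spread (\<epsilon> + \<delta>) J"
    if K: "K \<in> ivls"
      and hom: "\<And>R S. R \<in> ivls \<Longrightarrow> S \<in> ivls \<Longrightarrow> R \<subseteq> K \<Longrightarrow> S \<subseteq> K \<Longrightarrow> ev_overlap f R S"
    for K
  proof -
    obtain \<delta> \<R> where \<R>: "\<delta> > 0" "finite \<R>" "\<R> \<noteq> {}" "\<R> \<subseteq> ivls" "\<Union>\<R> \<subseteq> K"
      "\<forall>r. (\<forall>R\<in>\<R>. r R \<in> ivls \<and> r R \<subseteq> R) \<longrightarrow> spread (\<epsilon> + \<delta>) (\<Union>R\<in>\<R>. r R)"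
      using H[OF K] by (elim exE conjE) (rule that)
    obtain n M where M: "M \<in> ivls" "\<And>R. R \<in> \<R> \<Longrightarrow> M \<subseteq> (f ^^ n) ` R"
      using homogeneous_common_image[OF hom \<R>(2-5)] by blast
    have her: "spread (\<epsilon> + \<delta>) P" if P: "P \<in> ivls" "P \<subseteq> M" for P
    proof -
      \<comment> \<open>Each member of the family is shrunk so that its image at time n lies in P;
        the spread of the shrunken union is then inherited by P.\<close>
      have "\<forall>R\<in>\<R>. \<exists>Q\<in>ivls. Q \<subseteq> R \<and> (f ^^ n) ` Q \<subseteq> P"
        using ivls_preimage[OF _ P(1)] P(2) M(2) \<R>(4) by (meson subset_iff)
      then obtain r where r: "\<And>R. R \<in> \<R> \<Longrightarrow> r R \<in> ivls \<and> r R \<subseteq> R \<and> (f ^^ n) ` r R \<subseteq> P"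
        by metis
      then have "spread (\<epsilon> + \<delta>) (\<Union>R\<in>\<R>. r R)" using \<R>(6)[rule_format, of r] by blast
      then have "spread (\<epsilon> + \<delta>) ((f ^^ n) ` (\<Union>R\<in>\<R>. r R))" unfolding spread_image .
      then show ?thesis by (rule spread_mono) (use r in blast, simp)
    qed
    have "spread (\<epsilon> + \<delta>) J" if J: "J \<in> ivls" "ev_overlap f J K" for J
    proof -
      obtain p Q where Q: "Q \<in> ivls" "Q \<subseteq> (f ^^ p) ` J" "Q \<subseteq> (f ^^ p) ` K"
        using J(2) unfolding ev_overlap_def by blast
      \<comment> \<open>K1 is carried into an image of J, and K2 below into M. An overlap S of their
        images, moved on by n + p steps, gives an interval W lying both in an image of J and in an
        image of M.\<close>
      obtain K1 where K1: "K1 \<in> ivls" "K1 \<subseteq> K" "(f ^^ p) ` K1 \<subseteq> Q"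
        using ivls_preimage[OF K Q(1,3)] by blast
      obtain R where "R \<in> \<R>" using \<R>(3) by blast
      then have "M \<subseteq> (f ^^ n) ` K" using M(2)[of R] \<R>(5) by blast
      then obtain K2 where K2: "K2 \<in> ivls" "K2 \<subseteq> K" "(f ^^ n) ` K2 \<subseteq> M"
        using ivls_preimage[OF K M(1)] by blast
      obtain q S where S: "S \<in> ivls" "S \<subseteq> (f ^^ q) ` K1" "S \<subseteq> (f ^^ q) ` K2"
        using hom[OF K1(1) K2(1) K1(2) K2(2)] unfolding ev_overlap_def by blast
      define W where "W = (f ^^ n) ` (f ^^ p) ` S"
      have W: "W \<in> ivls" using S(1) by (simp add: W_def)
      have "W \<subseteq> (f ^^ n) ` (f ^^ p) ` (f ^^ q) ` K2"
        unfolding W_def using S(3) by (intro image_mono)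
      also have "\<dots> = (f ^^ p) ` (f ^^ q) ` (f ^^ n) ` K2"
        by (simp only: funpow_image_add[symmetric] ac_simps)
      also have "\<dots> \<subseteq> (f ^^ (p + q)) ` M"
        unfolding funpow_image_add using K2(3) by (intro image_mono)
      finally obtain P where P: "P \<in> ivls" "P \<subseteq> M" "(f ^^ (p + q)) ` P \<subseteq> W"
        using ivls_preimage[OF M(1) W] by blast
      have "spread (\<epsilon> + \<delta>) W"
        using her[OF P(1,2)] spread_mono[OF _ P(3)] spread_image by blast
      moreover have "W \<subseteq> (f ^^ (n + q + p)) ` J"
      proof -
        have "W \<subseteq> (f ^^ n) ` (f ^^ p) ` (f ^^ q) ` K1"
          unfolding W_def using S(2) by (intro image_mono)
        also have "\<dots> = (f ^^ n) ` (f ^^ q) ` (f ^^ p) ` K1"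
          by (subst funpow_image_commute[of p q]) (rule refl)
        also have "\<dots> \<subseteq> (f ^^ (n + q + p)) ` J"
          unfolding funpow_image_add by (rule image_mono[OF image_mono[OF subset_trans[OF K1(3) Q(2)]]])
        finally show ?thesis .
      qed
      ultimately show ?thesis using spread_mono spread_image by blast
    qed
    then show ?thesis using \<R>(1) by blast
  qed
  show thesis
  proof (cases "\<forall>R\<in>ivls. \<forall>S\<in>ivls. ev_overlap f R S")
    case True
    have I: "{0..1} \<in> ivls" by (rule ivlsI) auto
    then obtain \<delta> where "\<delta> > 0" "\<And>J. J \<in> ivls \<Longrightarrow> spread (\<epsilon> + \<delta>) J"
      using hom_spread[OF I] True by blast
    then show thesis using that[of "\<epsilon> + \<delta>"] by simp
  next
    case False
    then obtain K1 K2 where K: "K1 \<in> ivls" "K2 \<in> ivls" "\<not> ev_overlap f K1 K2" by blast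
    \<comment> \<open>Subintervals of A cannot overlap with B, since A does not; by the
      three-interval theorem they overlap with each other. So K1 and K2 are both homogeneous, and
      every J overlaps one of them.\<close>
    have hom: "ev_overlap f R S"
      if "R \<in> ivls" "S \<in> ivls" "R \<subseteq> A" "S \<subseteq> A" "B \<in> ivls" "\<not> ev_overlap f A B" for R S A B
      using three_intervals[of R S B] that ev_overlap_mono[of f _ B A B] by blast
    have K': "\<not> ev_overlap f K2 K1" using K(3) ev_overlap_sym by blast
    obtain \<delta>1 where \<delta>1: "\<delta>1 > 0" "\<And>J. J \<in> ivls \<Longrightarrow> ev_overlap f J K1 \<Longrightarrow> spread (\<epsilon> + \<delta>1) J"
      using hom_spread[OF K(1) hom[OF _ _ _ _ K(2,3)]] by blast
    obtain \<delta>2 where \<delta>2: "\<delta>2 > 0" "\<And>J. J \<in> ivls \<Longrightarrow> ev_overlap f J K2 \<Longrightarrow> spread (\<epsilon> + \<delta>2) J"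
      using hom_spread[OF K(2) hom[OF _ _ _ _ K(1) K']] by blast
    have "spread (\<epsilon> + min \<delta>1 \<delta>2) J" if J: "J \<in> ivls" for J
    proof -
      have "ev_overlap f J K1 \<or> ev_overlap f J K2" using three_intervals[OF J K(1,2)] K(3) by blast
      then show ?thesis using \<delta>1(2)[OF J] \<delta>2(2)[OF J] spread_mono[of _ J J] by fastforce
    qed
    then show thesis using that[of "\<epsilon> + min \<delta>1 \<delta>2"] \<delta>1(1) \<delta>2(1) by simp
  qed
qed

end

section \<open>Residual sets\<close>

lemma residual_inI:
  assumes S: "S \<subseteq> topspace T" and U: "countable \<U>"
    and dense: "\<And>U. U \<in> \<U> \<Longrightarrow> openin T U \<and> T closure_of U = topspace T"
    and sub: "topspace T \<inter> \<Inter>\<U> \<subseteq> S"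
  shows "residual_in T S"
  unfolding residual_in_def first_category_in_def
proof (intro conjI exI ballI)
  \<comment> \<open>\<open>first_category_in\<close> asks for equality with the union, so the
    complements of the dense open sets are cut down to the complement of S.\<close>
  let ?N = "(\<lambda>U. (topspace T - S) - U) ` \<U>"
  show "countable ?N" using U by simp
  show "topspace T - S = \<Union>?N" using sub by blast
  fix N assume "N \<in> ?N"
  then obtain U where N: "U \<in> \<U>" "N = (topspace T - S) - U" by blast
  have "T closure_of N \<subseteq> T closure_of (topspace T - U)" using N by (intro closure_of_mono) blast
  also have "\<dots> = topspace T - U"
    using dense[OF N(1)] by (simp add: closure_of_complement interior_of_openin)
  finally have "T interior_of (T closure_of N) \<subseteq> T interior_of (topspace T - U)"
    by (rule interior_of_mono)
  also have "\<dots> = {}" using dense[OF N(1)] by (simp add: interior_of_complement)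
  finally show "nowhere_dense_in T N" using N by (auto simp: nowhere_dense_in_def)
qed (fact S)

text \<open>Baire category theorem: U is covered by the closures of the sets D k \<inter> U and of
  the nowhere dense sets that make up the complement of S, so some D k is dense in a nonempty open
  part of U. The index type of D is left open; a constant family gives the mere density of
  S.\<close>

lemma residual_in_rectangle:
  assumes X: "completely_metrizable_space X" and S: "residual_in (prod_topology X X) S"
    and U: "openin (prod_topology X X) U" "U \<noteq> {}" and D: "S \<inter> U \<subseteq> (\<Union>k. D k)" "countable (range D)"
  obtains k V1 V2 where "openin X V1" "openin X V2" "V1 \<noteq> {}" "V2 \<noteq> {}" "V1 \<times> V2 \<subseteq> U"
    "\<And>W1 W2. openin X W1 \<Longrightarrow> openin X W2 \<Longrightarrow> W1 \<noteq> {} \<Longrightarrow> W2 \<noteq> {} \<Longrightarrow> W1 \<subseteq> V1 \<Longrightarrow> W2 \<subseteq> V2 \<Longrightarrow>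
      W1 \<times> W2 \<inter> D k \<noteq> {}"
proof -
  let ?T = "prod_topology X X"
  have T: "completely_metrizable_space ?T" using X by (simp add: completely_metrizable_space_prod_topology)
  obtain \<N> where N: "countable \<N>" "\<And>N. N \<in> \<N> \<Longrightarrow> nowhere_dense_in ?T N" "topspace ?T - S = \<Union>\<N>"
    using S unfolding residual_in_def first_category_in_def by (elim conjE exE) (rule that; blast)
  have Usub: "U \<subseteq> topspace ?T" using U(1) by (rule openin_subset)
  have "\<exists>k. ?T interior_of (?T closure_of (D k \<inter> U)) \<noteq> {}"
  proof (rule ccontr)
    assume *: "\<not> ?thesis"
    let ?G = "(closure_of) ?T ` \<N> \<union> (\<lambda>A. ?T closure_of (A \<inter> U)) ` range D"
    have "?T interior_of \<Union>?G = {}"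
    proof (rule Baire_category_alt)
      fix A assume "A \<in> ?G"
      then consider N where "N \<in> \<N>" "A = ?T closure_of N" | k where "A = ?T closure_of (D k \<inter> U)"
        by blast
      then show "closedin ?T A \<and> ?T interior_of A = {}"
        by cases (use N(2) * in \<open>auto simp: nowhere_dense_in_def\<close>)
    qed (use T N(1) D(2) in auto)
    moreover have "U \<subseteq> \<Union>?G"
    proof
      fix p assume p: "p \<in> U"
      show "p \<in> \<Union>?G"
      proof (cases "p \<in> S")
        case True
        then obtain k where "p \<in> D k \<inter> U" using D p by blast
        moreover have "D k \<inter> U \<subseteq> ?T closure_of (D k \<inter> U)"
          using Usub by (intro closure_of_subset) blast
        ultimately show ?thesis by blast
      next
        case False
        then have "p \<in> \<Union>\<N>" using p Usub N(3) by blast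
        then obtain A where A: "A \<in> \<N>" "p \<in> A" by blast
        then have "A \<subseteq> ?T closure_of A" using N(2) by (intro closure_of_subset) (auto simp: nowhere_dense_in_def)
        then show ?thesis using A by blast
      qed
    qed
    ultimately show False using interior_of_maximal[OF _ U(1)] U(2) by blast
  qed
  then obtain k where k: "?T interior_of (?T closure_of (D k \<inter> U)) \<noteq> {}" by blast
  define G where "G = ?T interior_of (?T closure_of (D k \<inter> U))"
  have G: "openin ?T G" "G \<subseteq> ?T closure_of (D k \<inter> U)" "G \<noteq> {}"
    using k by (auto simp: G_def interior_of_subset)
  have meet: "W \<inter> (D k \<inter> U) \<noteq> {}" if "openin ?T W" "W \<subseteq> G" "W \<noteq> {}" for W
    using that G(2) by (meson disjoint_iff in_closure_of subset_iff ex_in_conv)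
  have "G \<inter> U \<noteq> {}" using meet[OF G(1) _ G(3)] by blast
  then obtain a b where ab: "(a, b) \<in> G \<inter> U" by (metis all_not_in_conv surj_pair)
  have "openin ?T (G \<inter> U)" using G(1) U(1) by (rule openin_Int)
  from this[unfolded openin_prod_topology_alt, rule_format, OF ab]
  obtain V1 V2 where V: "openin X V1" "openin X V2" "a \<in> V1" "b \<in> V2" "V1 \<times> V2 \<subseteq> G \<inter> U"
    by (elim conjE exE) (rule that)
  show thesis
  proof (rule that[OF V(1,2)])
    fix W1 W2 assume W: "openin X W1" "openin X W2" "W1 \<noteq> {}" "W2 \<noteq> {}" "W1 \<subseteq> V1" "W2 \<subseteq> V2"
    then have "W1 \<times> W2 \<subseteq> G" using V(5) by blast
    moreover have "openin ?T (W1 \<times> W2)" using W by (simp add: openin_prod_Times_iff)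
    ultimately show "W1 \<times> W2 \<inter> D k \<noteq> {}" using meet[of "W1 \<times> W2"] W(3,4) by blast
  qed (use V in auto)
qed

lemma openin_mtopology_of:
  "openin (mtopology_of m) U \<longleftrightarrow> U \<subseteq> mspace m \<and> (\<forall>x\<in>U. \<exists>r>0. mball_of m x r \<subseteq> U)"
  unfolding mtopology_of_def mball_of_def
  using Metric_space.openin_mtopology[OF Metric_space_mspace_mdist, of m] by blast

lemma openin_mball_of: "openin (mtopology_of m) (mball_of m x r)"
  unfolding mtopology_of_def mball_of_def
  by (rule Metric_space.openin_mball[OF Metric_space_mspace_mdist])

lemma openin_prod_mtopologyI:
  assumes "S \<subseteq> mspace m \<times> mspace m"
    and "\<And>x y. (x, y) \<in> S \<Longrightarrow> \<exists>r>0. mball_of m x r \<times> mball_of m y r \<subseteq> S"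
  shows "openin (prod_topology (mtopology_of m) (mtopology_of m)) S"
  unfolding openin_prod_topology_alt
proof (intro allI impI)
  fix x y assume xy: "(x, y) \<in> S"
  then obtain r where r: "r > 0" "mball_of m x r \<times> mball_of m y r \<subseteq> S" using assms(2) by blast
  moreover have "x \<in> mspace m" "y \<in> mspace m" using xy assms(1) by auto
  ultimately show "\<exists>U V. openin (mtopology_of m) U \<and> openin (mtopology_of m) V \<and> x \<in> U \<and> y \<in> V \<and> U \<times> V \<subseteq> S"
    using openin_mball_of[of m x r] openin_mball_of[of m y r]
    by (metis in_mball_of mdist_zero)
qed

lemma dense_prod_mtopologyI:
  assumes "\<And>x y r. x \<in> mspace m \<Longrightarrow> y \<in> mspace m \<Longrightarrow> r > 0 \<Longrightarrow>
      mball_of m x r \<times> mball_of m y r \<inter> S \<noteq> {}"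
  shows "prod_topology (mtopology_of m) (mtopology_of m) closure_of S =
    topspace (prod_topology (mtopology_of m) (mtopology_of m))"
  unfolding dense_intersects_open
proof (intro allI impI, elim conjE)
  fix T assume T: "openin (prod_topology (mtopology_of m) (mtopology_of m)) T" "T \<noteq> {}"
  then obtain x y where xy: "(x, y) \<in> T" by (metis all_not_in_conv surj_pair)
  obtain U V where UV: "openin (mtopology_of m) U" "openin (mtopology_of m) V" "x \<in> U" "y \<in> V"
    "U \<times> V \<subseteq> T"
    using T(1)[unfolded openin_prod_topology_alt, rule_format, OF xy] by (elim conjE exE) (rule that)
  obtain r where r: "r > 0" "mball_of m x r \<subseteq> U"
    using UV(1,3) unfolding openin_mtopology_of by blast
  obtain s where s: "s > 0" "mball_of m y s \<subseteq> V"
    using UV(2,4) unfolding openin_mtopology_of by blast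
  have "x \<in> mspace m" "y \<in> mspace m" using UV(1-4) unfolding openin_mtopology_of by auto
  then have "mball_of m x (min r s) \<times> mball_of m y (min r s) \<inter> S \<noteq> {}" using assms r(1) s(1) by simp
  moreover have "mball_of m x (min r s) \<subseteq> U" "mball_of m y (min r s) \<subseteq> V" using r s by auto
  ultimately show "S \<inter> T \<noteq> {}" using UV(5) by blast
qed

section \<open>Lower and upper limits\<close>

lemma liminf_ereal_eq_0_iff:
  fixes u :: "nat \<Rightarrow> real"
  assumes "\<And>n. 0 \<le> u n"
  shows "liminf (\<lambda>n. ereal (u n)) = 0 \<longleftrightarrow> (\<forall>e>0. \<forall>N. \<exists>n\<ge>N. u n < e)"
proof
  assume L: "liminf (\<lambda>n. ereal (u n)) = 0"
  show "\<forall>e>0. \<forall>N. \<exists>n\<ge>N. u n < e"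
  proof (intro allI impI, rule ccontr)
    fix e :: real and N assume e: "e > 0" "\<not> (\<exists>n\<ge>N. u n < e)"
    then have "\<forall>\<^sub>F n in sequentially. ereal e \<le> ereal (u n)"
      unfolding eventually_sequentially by (auto simp: not_less)
    then have "ereal e \<le> liminf (\<lambda>n. ereal (u n))" by (rule Liminf_bounded)
    then show False using L e(1) by simp
  qed
next
  assume R: "\<forall>e>0. \<forall>N. \<exists>n\<ge>N. u n < e"
  have "0 \<le> liminf (\<lambda>n. ereal (u n))" by (rule Liminf_bounded) (use assms in auto)
  moreover have "liminf (\<lambda>n. ereal (u n)) \<le> 0"
  proof (rule ccontr)
    assume "\<not> ?thesis"
    then obtain e where e: "0 < ereal e" "ereal e < liminf (\<lambda>n. ereal (u n))"
      using ereal_dense2[of 0 "liminf (\<lambda>n. ereal (u n))"] by (auto simp: not_le)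
    have "\<forall>\<^sub>F n in sequentially. ereal e < ereal (u n)" by (rule less_LiminfD[OF e(2)])
    then obtain N where N: "\<forall>n\<ge>N. e < u n" unfolding eventually_sequentially by auto
    obtain n where "n \<ge> N" "u n < e" using R e(1) by (metis ereal_less(2))
    then show False using N by fastforce
  qed
  ultimately show "liminf (\<lambda>n. ereal (u n)) = 0" by simp
qed

text \<open>The margin is taken from a sequence so that the chaotic pairs fall into countably many
  classes, as the category argument requires.\<close>

lemma limsup_ereal_gt_imp:
  fixes u :: "nat \<Rightarrow> real"
  assumes "ereal \<epsilon> < limsup (\<lambda>n. ereal (u n))"
  shows "\<exists>k. \<forall>N. \<exists>n\<ge>N. \<epsilon> + inverse (real (Suc k)) < u n"
proof -
  obtain r where r: "ereal \<epsilon> < ereal r" "ereal r < limsup (\<lambda>n. ereal (u n))"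
    using ereal_dense2[OF assms] by blast
  obtain k where k: "inverse (real (Suc k)) < r - \<epsilon>" using reals_Archimedean[of "r - \<epsilon>"] r(1) by auto
  have "\<exists>n\<ge>N. r < u n" for N
  proof (rule ccontr)
    assume "\<not> ?thesis"
    then have "\<forall>\<^sub>F n in sequentially. ereal (u n) \<le> ereal r"
      unfolding eventually_sequentially by (auto simp: not_less)
    then have "limsup (\<lambda>n. ereal (u n)) \<le> ereal r" by (rule Limsup_bounded)
    then show False using r(2) by simp
  qed
  then have "\<forall>N. \<exists>n\<ge>N. \<epsilon> + inverse (real (Suc k)) < u n" using k by (smt (verit))
  then show ?thesis by blast
qed

lemma limsup_ereal_gtI:
  fixes u :: "nat \<Rightarrow> real"
  assumes "\<And>N. \<exists>n\<ge>N. c < u n" "\<epsilon> < c"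
  shows "ereal \<epsilon> < limsup (\<lambda>n. ereal (u n))"
proof (rule ccontr)
  assume "\<not> ?thesis"
  then have "limsup (\<lambda>n. ereal (u n)) \<le> ereal \<epsilon>" by simp
  moreover have "ereal \<epsilon> < ereal c" using assms(2) by simp
  ultimately have "\<forall>\<^sub>F n in sequentially. ereal (u n) < ereal c" unfolding Limsup_le_iff by blast
  then show False using assms(1) unfolding eventually_sequentially by fastforce
qed

lemma generically_chaotic_eps_0: "generically_chaotic m g \<longleftrightarrow> generically_eps_chaotic m 0 g"
  by (simp add: generically_chaotic_def generically_eps_chaotic_def chaotic_pairs_def
      eps_chaotic_pairs_def zero_ereal_def)

section \<open>The hyperspace of the unit interval\<close>

lemma hyperspace_unit_interval_iff:
  "K \<in> hyperspace_carrier unit_interval \<longleftrightarrow> K \<noteq> {} \<and> compact K \<and> K \<subseteq> {0..1}"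
  by (simp add: hyperspace_carrier_def mtopology_of_submetric compactin_subtopology)

abbreviation "hyp \<equiv> hyperspace_carrier unit_interval"
abbreviation "hd_dist \<equiv> hausdorff_dist unit_interval"

lemma hd_dist_lessD:
  assumes "A \<in> hyp" "B \<in> hyp" "hd_dist A B < r" "x \<in> A"
  shows "\<exists>y\<in>B. \<bar>x - y\<bar> < r"
proof (rule ccontr)
  assume "\<not> ?thesis"
  then have "r \<le> point_set_dist unit_interval x B"
    using assms(2) by (intro point_set_dist_greatest) (auto simp: hyperspace_carrier_def not_less dist_real_def)
  then show False using hausdorff_dist_upper[OF assms(1,2,4)] assms(3) by simp
qed

lemma hd_dist_leI:
  assumes "A \<in> hyp" "B \<in> hyp" "\<And>x. x \<in> A \<Longrightarrow> \<exists>y\<in>B. \<bar>x - y\<bar> \<le> r"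
    "\<And>y. y \<in> B \<Longrightarrow> \<exists>x\<in>A. \<bar>x - y\<bar> \<le> r"
  shows "hd_dist A B \<le> r"
proof (rule hausdorff_dist_least[OF assms(1,2)])
  fix x assume "x \<in> A"
  then obtain y where "y \<in> B" "\<bar>x - y\<bar> \<le> r" using assms(3) by blast
  then show "point_set_dist unit_interval x B \<le> r"
    using point_set_dist_le[of y B unit_interval x] by (simp add: dist_real_def)
next
  fix y assume "y \<in> B"
  then obtain x where "x \<in> A" "\<bar>x - y\<bar> \<le> r" using assms(4) by blast
  then show "point_set_dist unit_interval y A \<le> r"
    using point_set_dist_le[of x A unit_interval y] by (simp add: dist_real_def abs_minus_commute)
qed

lemma hd_dist_greaterD:
  assumes "A \<in> hyp" "B \<in> hyp" "r < hd_dist A B"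
  shows "\<exists>x\<in>A. \<exists>y\<in>B. r < \<bar>x - y\<bar>"
proof (rule ccontr)
  assume "\<not> ?thesis"
  then have "hd_dist A B \<le> r"
    using assms(1,2) by (intro hd_dist_leI) (auto simp: hyperspace_carrier_def not_less)
  then show False using assms(3) by simp
qed

lemma hd_dist_geI:
  assumes "A \<in> hyp" "B \<in> hyp" "x \<in> A" "\<And>y. y \<in> B \<Longrightarrow> c \<le> \<bar>x - y\<bar>"
  shows "c \<le> hd_dist A B"
  using hd_dist_lessD[OF assms(1,2) _ assms(3), of c] assms(4) by force

lemma hd_dist_triangle:
  "A \<in> hyp \<Longrightarrow> B \<in> hyp \<Longrightarrow> C \<in> hyp \<Longrightarrow> hd_dist A C \<le> hd_dist A B + hd_dist B C"
  by (rule Metric_space.triangle[OF Metric_space_hyperspace])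

lemma hd_dist_singleton:
  assumes "x \<in> {0..1}" "y \<in> {0..1}"
  shows "hd_dist {x} {y} = \<bar>x - y\<bar>"
proof (rule antisym)
  have *: "{x} \<in> hyp" "{y} \<in> hyp" using assms by (auto simp: hyperspace_unit_interval_iff)
  show "hd_dist {x} {y} \<le> \<bar>x - y\<bar>" by (rule hd_dist_leI[OF *]) auto
  show "\<bar>x - y\<bar> \<le> hd_dist {x} {y}" by (rule hd_dist_geI[OF *]) auto
qed

lemma finite_in_hyp: "finite F \<Longrightarrow> F \<noteq> {} \<Longrightarrow> F \<subseteq> {0..1} \<Longrightarrow> F \<in> hyp"
  by (simp add: hyperspace_unit_interval_iff finite_imp_compact)

text \<open>F is an r/4-net in A; moving its points by at most r/4 keeps the distance to A within
  r/2. So every point of F has a whole interval at its disposal.\<close>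

lemma hyp_finite_approx:
  assumes A: "A \<in> hyp" and r: "r > 0"
  obtains F where "finite F" "F \<noteq> {}" "F \<subseteq> {0..1}"
    "\<And>c. (\<And>a. a \<in> F \<Longrightarrow> c a \<in> {0..1} \<and> \<bar>c a - a\<bar> \<le> r / 4) \<Longrightarrow> c ` F \<in> hyp \<and> hd_dist A (c ` F) < r"
proof -
  have A': "A \<noteq> {}" "compact A" "A \<subseteq> {0..1}" using A by (auto simp: hyperspace_unit_interval_iff)
  have "A \<subseteq> (\<Union>a\<in>A. ball a (r / 4))" using r by force
  then obtain F where F: "F \<subseteq> A" "finite F" "A \<subseteq> (\<Union>a\<in>F. ball a (r / 4))"
    using compactE_image[OF A'(2), of A "\<lambda>a. ball a (r / 4)"] by blast
  have ne: "F \<noteq> {}" using F(3) A'(1) by auto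
  show thesis
  proof (rule that[OF F(2) ne])
    show "F \<subseteq> {0..1}" using F(1) A'(3) by blast
    fix c assume c: "\<And>a. a \<in> F \<Longrightarrow> c a \<in> {0..1} \<and> \<bar>c a - a\<bar> \<le> r / 4"
    have cF: "c ` F \<in> hyp" using F(2) ne c by (intro finite_in_hyp) auto
    have "hd_dist A (c ` F) \<le> r / 2"
    proof (rule hd_dist_leI[OF A cF])
      fix x assume "x \<in> A"
      then obtain a where a: "a \<in> F" "\<bar>a - x\<bar> < r / 4" using F(3) by (auto simp: dist_real_def)
      then have "\<bar>x - c a\<bar> \<le> r / 2" using c[of a] by linarith
      then show "\<exists>y\<in>c ` F. \<bar>x - y\<bar> \<le> r / 2" using a by blast
    next
      fix y assume "y \<in> c ` F"
      then obtain a where a: "a \<in> F" "y = c a" by blast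
      then have "\<bar>a - y\<bar> \<le> r / 2" using c[of a] by linarith
      then show "\<exists>x\<in>A. \<bar>x - y\<bar> \<le> r / 2" using a F(1) by blast
    qed
    then show "c ` F \<in> hyp \<and> hd_dist A (c ` F) < r" using cF r by simp
  qed
qed

text \<open>The limit of a Cauchy sequence is the set of its cluster points.\<close>

lemma completely_metrizable_hyperspace:
  "completely_metrizable_space (mtopology_of (hyperspace unit_interval))"
proof -
  interpret H: Metric_space hyp hd_dist by (rule Metric_space_hyperspace)
  have "H.mcomplete" unfolding H.mcomplete_def
  proof (intro allI impI)
    fix S assume "H.MCauchy S"
    then have rng: "range S \<subseteq> hyp"
      and cau: "\<And>e. e > 0 \<Longrightarrow> \<exists>N. \<forall>n\<ge>N. \<forall>n'\<ge>N. hd_dist (S n) (S n') < e"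
      unfolding H.MCauchy_def by simp_all
    have S: "S n \<in> hyp" for n using rng by (rule range_subsetD)
    have S': "S n \<noteq> {}" "compact (S n)" "S n \<subseteq> {0..1}" for n
      using S[of n] by (auto simp: hyperspace_unit_interval_iff)
    define C where "C = (\<lambda>N. closure (\<Union>n\<in>{N..}. S n))"
    define K where "K = (\<Inter>N. C N)"
    have C01: "C N \<subseteq> {0..1}" for N
      unfolding C_def using S'(3) by (intro closure_minimal) auto
    have cpt: "compact K"
    proof -
      have "closed K" unfolding K_def C_def by auto
      moreover have "K \<subseteq> {0..1}" using C01[of 0] unfolding K_def by blast
      then have "bounded K" by (rule bounded_subset[rotated]) simp
      ultimately show ?thesis by (simp add: compact_eq_bounded_closed)
    qed
    \<comment> \<open>A point of a late S n has points of all S (N + j) within e; a convergent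
      subsequence of these leads to a point of K.\<close>
    have close: "\<exists>y\<in>K. \<bar>x - y\<bar> \<le> e"
      if "x \<in> S n" "n \<ge> N" and N: "\<forall>n\<ge>N. \<forall>n'\<ge>N. hd_dist (S n) (S n') < e" for x n N e
    proof -
      have "\<exists>y\<in>S (N + j). \<bar>x - y\<bar> < e" for j
        using hd_dist_lessD[OF S S _ that(1), of "N + j"] N that(2) by auto
      then obtain Y where Y: "\<And>j. Y j \<in> S (N + j)" "\<And>j. \<bar>x - Y j\<bar> < e" by metis
      have "\<forall>j. Y j \<in> {0..1}" using Y(1) S'(3) by blast
      then obtain l \<rho> where l: "strict_mono \<rho>" "(Y \<circ> \<rho>) \<longlonglongrightarrow> l"
        using compact_Icc[of 0 "1::real"] unfolding compact_def by metis
      have "l \<in> C M" for M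
      proof -
        have "(Y \<circ> \<rho>) j \<in> C M" if "j \<ge> M" for j
        proof -
          have "N + \<rho> j \<ge> M" using seq_suble[OF l(1), of j] that by simp
          then show ?thesis unfolding C_def using Y(1)[of "\<rho> j"]
            by (intro subsetD[OF closure_subset]) auto
        qed
        then have ev: "\<forall>\<^sub>F j in sequentially. (Y \<circ> \<rho>) j \<in> C M"
          unfolding eventually_sequentially by blast
        show ?thesis by (rule Lim_in_closed_set[OF _ ev _ l(2)]) (auto simp: C_def)
      qed
      moreover have "\<bar>x - l\<bar> \<le> e"
      proof (rule tendsto_upperbound)
        show "(\<lambda>j. \<bar>x - (Y \<circ> \<rho>) j\<bar>) \<longlonglongrightarrow> \<bar>x - l\<bar>" by (intro tendsto_intros l(2))
        show "\<forall>\<^sub>F j in sequentially. \<bar>x - (Y \<circ> \<rho>) j\<bar> \<le> e" using Y(2) by (simp add: less_imp_le)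
      qed simp
      ultimately show ?thesis unfolding K_def by blast
    qed
    have K: "K \<in> hyp"
    proof -
      obtain N where "\<forall>n\<ge>N. \<forall>n'\<ge>N. hd_dist (S n) (S n') < 1" using cau[of 1] by auto
      moreover obtain x where "x \<in> S N" using S'(1) by blast
      ultimately have "K \<noteq> {}" using close[of x N N 1] by blast
      then show ?thesis using cpt C01[of 0] by (auto simp: hyperspace_unit_interval_iff K_def)
    qed
    have "\<forall>\<^sub>F n in sequentially. S n \<in> hyp \<and> hd_dist (S n) K < e" if e: "e > 0" for e
    proof -
      obtain N where N: "\<forall>n\<ge>N. \<forall>n'\<ge>N. hd_dist (S n) (S n') < e / 3" using cau[of "e / 3"] e by auto
      have "hd_dist (S n) K \<le> 2 * e / 3" if n: "n \<ge> N" for n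
      proof (rule hd_dist_leI[OF S K])
        fix x assume "x \<in> S n"
        then obtain y where "y \<in> K" "\<bar>x - y\<bar> \<le> e / 3" using close[OF _ n N] by blast
        then show "\<exists>y\<in>K. \<bar>x - y\<bar> \<le> 2 * e / 3" using e by (intro bexI[of _ y]) auto
      next
        fix y assume "y \<in> K"
        then have "y \<in> closure (\<Union>n\<in>{N..}. S n)" unfolding K_def C_def by blast
        then obtain z where z: "z \<in> (\<Union>n\<in>{N..}. S n)" "dist z y < e / 3"
          unfolding closure_approachable using e by (meson divide_pos_pos zero_less_numeral)
        then obtain m where m: "m \<ge> N" "z \<in> S m" by auto
        obtain x where "x \<in> S n" "\<bar>z - x\<bar> < e / 3"
          using hd_dist_lessD[OF S S _ m(2), of n "e / 3"] N m(1) n by blast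
        moreover from this have "\<bar>x - y\<bar> \<le> 2 * e / 3" using z(2) unfolding dist_real_def by linarith
        ultimately show "\<exists>x\<in>S n. \<bar>x - y\<bar> \<le> 2 * e / 3" by blast
      qed
      moreover have "2 * e / 3 < e" using e by simp
      ultimately show ?thesis unfolding eventually_sequentially using S by (meson le_less_trans)
    qed
    then have "limitin H.mtopology S K sequentially" unfolding H.limitin_metric using K by blast
    then show "\<exists>K. limitin H.mtopology S K sequentially" by blast
  qed
  then show ?thesis
    unfolding mtopology_of_def mspace_hyperspace mdist_hyperspace
    by (rule H.completely_metrizable_space_mtopology)
qed

section \<open>Generic chaos on the hyperspace\<close>

lemma induced_map_funpow: "(induced_map f ^^ n) A = (f ^^ n) ` A"
  by (induction n) (auto simp: image_comp)

section \<open>Continuity of the distance between images\<close>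

context interval_map
begin

lemma funpow_hyp: "A \<in> hyp \<Longrightarrow> (f ^^ n) ` A \<in> hyp"
  unfolding hyperspace_unit_interval_iff
  by (intro conjI funpow_image_subset compact_continuous_image continuous_on_subset[OF funpow_cont]) auto

lemma hd_dist_image_continuous:
  assumes A: "A \<in> hyp" and B: "B \<in> hyp" and e: "e > 0"
  obtains d where "d > 0" "\<And>A' B'. A' \<in> hyp \<Longrightarrow> B' \<in> hyp \<Longrightarrow> hd_dist A A' < d \<Longrightarrow> hd_dist B B' < d \<Longrightarrow>
      \<bar>hd_dist ((f ^^ n) ` A') ((f ^^ n) ` B') - hd_dist ((f ^^ n) ` A) ((f ^^ n) ` B)\<bar> < e"
proof -
  obtain d where d: "d > 0"
    "\<And>x y. x \<in> {0..1} \<Longrightarrow> y \<in> {0..1} \<Longrightarrow> \<bar>x - y\<bar> < d \<Longrightarrow> \<bar>(f ^^ n) x - (f ^^ n) y\<bar> < e / 3"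
    using funpow_uniform[of "e / 3" n] e by auto
  have le: "hd_dist ((f ^^ n) ` C) ((f ^^ n) ` D) \<le> e / 3"
    if CD: "C \<in> hyp" "D \<in> hyp" "hd_dist C D < d" for C D
  proof (rule hd_dist_leI[OF funpow_hyp[OF CD(1)] funpow_hyp[OF CD(2)]])
    have sub: "C \<subseteq> {0..1}" "D \<subseteq> {0..1}" using CD by (auto simp: hyperspace_unit_interval_iff)
    fix x assume "x \<in> (f ^^ n) ` C"
    then obtain u where u: "u \<in> C" "x = (f ^^ n) u" by blast
    obtain v where v: "v \<in> D" "\<bar>u - v\<bar> < d" using hd_dist_lessD[OF CD u(1)] by blast
    have "\<bar>x - (f ^^ n) v\<bar> < e / 3" unfolding u(2) using d(2)[of u v] u v sub by blast
    then show "\<exists>y\<in>(f ^^ n) ` D. \<bar>x - y\<bar> \<le> e / 3" using v(1) by (intro bexI[of _ "(f ^^ n) v"]) auto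
  next
    have sub: "C \<subseteq> {0..1}" "D \<subseteq> {0..1}" using CD by (auto simp: hyperspace_unit_interval_iff)
    fix y assume "y \<in> (f ^^ n) ` D"
    then obtain v where v: "v \<in> D" "y = (f ^^ n) v" by blast
    have "hd_dist D C < d" using CD(3) by (simp add: hausdorff_dist_commute)
    then obtain u where u: "u \<in> C" "\<bar>v - u\<bar> < d" using hd_dist_lessD[OF CD(2,1) _ v(1)] by blast
    have "\<bar>(f ^^ n) v - (f ^^ n) u\<bar> < e / 3" using d(2)[of v u] u v sub by blast
    then show "\<exists>x\<in>(f ^^ n) ` C. \<bar>x - y\<bar> \<le> e / 3"
      using u(1) unfolding v(2) by (intro bexI[of _ "(f ^^ n) u"]) (auto simp: abs_minus_commute)
  qed
  show thesis
  proof (rule that[OF d(1)])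
    fix A' B' assume h: "A' \<in> hyp" "B' \<in> hyp" "hd_dist A A' < d" "hd_dist B B' < d"
    let ?h = "\<lambda>C D. hd_dist ((f ^^ n) ` C) ((f ^^ n) ` D)"
    have tri: "?h C E \<le> ?h C D + ?h D E" if "C \<in> hyp" "D \<in> hyp" "E \<in> hyp" for C D E
      using that by (intro hd_dist_triangle funpow_hyp)
    have com: "?h C D = ?h D C" for C D by (rule hausdorff_dist_commute)
    have "?h A A' \<le> e / 3" "?h B B' \<le> e / 3" using le A B h by auto
    moreover have "?h A' B' \<le> ?h A' A + ?h A B'" "?h A B' \<le> ?h A B + ?h B B'"
      "?h A B \<le> ?h A A' + ?h A' B" "?h A' B \<le> ?h A' B' + ?h B' B"
      using A B h by (auto intro: tri)
    ultimately show "\<bar>?h A' B' - ?h A B\<bar> < e" using com[of A' A] com[of B' B] e by linarith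
  qed
qed

text \<open>At each fixed time the distance of the images depends continuously on the pair. With a
  ray for W this covers both the proximal and the separated condition.\<close>

lemma openin_image_dist:
  assumes "open W"
  shows "openin (prod_topology (mtopology_of (hyperspace unit_interval)) (mtopology_of (hyperspace unit_interval)))
    {(A, B). A \<in> hyp \<and> B \<in> hyp \<and> (\<exists>n\<ge>N. hd_dist ((f ^^ n) ` A) ((f ^^ n) ` B) \<in> W)}" (is "openin _ ?S")
proof (rule openin_prod_mtopologyI)
  show "?S \<subseteq> mspace (hyperspace unit_interval) \<times> mspace (hyperspace unit_interval)"
    by (auto simp: mspace_hyperspace)
  fix A B assume "(A, B) \<in> ?S"
  then obtain n where n: "A \<in> hyp" "B \<in> hyp" "n \<ge> N" "hd_dist ((f ^^ n) ` A) ((f ^^ n) ` B) \<in> W" by auto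
  obtain e where e: "e > 0" "ball (hd_dist ((f ^^ n) ` A) ((f ^^ n) ` B)) e \<subseteq> W"
    using assms n(4) open_contains_ball by blast
  obtain d where d: "d > 0" "\<And>A' B'. A' \<in> hyp \<Longrightarrow> B' \<in> hyp \<Longrightarrow> hd_dist A A' < d \<Longrightarrow> hd_dist B B' < d \<Longrightarrow>
      \<bar>hd_dist ((f ^^ n) ` A') ((f ^^ n) ` B') - hd_dist ((f ^^ n) ` A) ((f ^^ n) ` B)\<bar> < e"
    by (rule hd_dist_image_continuous[OF n(1,2) e(1)]) blast
  have "(A', B') \<in> ?S" if "A' \<in> hyp" "B' \<in> hyp" "hd_dist A A' < d" "hd_dist B B' < d" for A' B'
  proof -
    have "hd_dist ((f ^^ n) ` A') ((f ^^ n) ` B') \<in> W"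
      using d(2)[OF that] e(2) by (auto simp: dist_real_def abs_minus_commute)
    then show ?thesis using that n(3) by auto
  qed
  then show "\<exists>r>0. mball_of (hyperspace unit_interval) A r \<times> mball_of (hyperspace unit_interval) B r \<subseteq> ?S"
    using d(1) by (intro exI[of _ d]) (auto simp: mspace_hyperspace mdist_hyperspace)
qed

end

section \<open>Density of the chaos conditions in the hyperspace\<close>

context spreading_map
begin

text \<open>If L1 and L2 overlap at time p, one common interval replaces both. Otherwise their
  images lie side by side at all times, on which the choice of far points relies.\<close>

lemma finite_cluster_separated:
  assumes "finite \<J>" "\<J> \<subseteq> ivls" "J0 \<in> \<J>"
  obtains n L1 L2 where "L1 \<in> ivls" "L2 \<in> ivls" "L1 \<subseteq> (f ^^ n) ` J0"
    "\<And>J. J \<in> \<J> \<Longrightarrow> L1 \<subseteq> (f ^^ n) ` J \<or> L2 \<subseteq> (f ^^ n) ` J" "L1 = L2 \<or> \<not> ev_overlap f L1 L2"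
proof -
  obtain n L1 L2 where L: "L1 \<in> ivls" "L2 \<in> ivls" "L1 \<subseteq> (f ^^ n) ` J0"
    "\<And>J. J \<in> \<J> \<Longrightarrow> L1 \<subseteq> (f ^^ n) ` J \<or> L2 \<subseteq> (f ^^ n) ` J"
    by (rule finite_cluster[OF assms]) blast
  show thesis
  proof (cases "ev_overlap f L1 L2")
    case True
    then obtain p K where K: "K \<in> ivls" "K \<subseteq> (f ^^ p) ` L1" "K \<subseteq> (f ^^ p) ` L2"
      unfolding ev_overlap_def by blast
    have sub: "K \<subseteq> (f ^^ (p + n)) ` J" if "L1 \<subseteq> (f ^^ n) ` J \<or> L2 \<subseteq> (f ^^ n) ` J" for J
      unfolding funpow_image_add using that K(2,3) image_mono by (meson subset_trans)
    show thesis by (rule that[OF K(1) K(1)]) (use sub L(3,4) in blast)+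
  next
    case False
    then show thesis using that[OF L] by simp
  qed
qed

text \<open>The point \<open>u\<close> is taken at the end of the image of \<open>L1\<close> that is farther from the image
  of \<open>L2\<close>.\<close>

lemma far_points:
  assumes L: "L1 \<in> ivls" "L2 \<in> ivls" "L1 = L2 \<or> \<not> ev_overlap f L1 L2" and c: "spread c L1"
  obtains n u v w where "n \<ge> N" "u \<in> L1" "v \<in> L1" "w \<in> L2"
    "c \<le> \<bar>(f ^^ n) u - (f ^^ n) v\<bar>" "c \<le> \<bar>(f ^^ n) u - (f ^^ n) w\<bar>"
proof -
  obtain n u v where n: "n \<ge> N" "u \<in> L1" "v \<in> L1" "c \<le> \<bar>(f ^^ n) u - (f ^^ n) v\<bar>"
    using c unfolding spread_def by blast
  show thesis
  proof (cases "L1 = L2")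
    case True
    then show thesis using that[OF n(1-3) _ n(4,4)] n(3) by simp
  next
    case False
    obtain w where w: "w \<in> L2" using ivls_nonempty[OF L(2)] by blast
    obtain a b where ab: "(f ^^ n) ` L1 = {a..b}" "a < b" by (rule ivlsE[OF image_ivls[OF L(1)]])
    obtain a' b' where ab': "(f ^^ n) ` L2 = {a'..b'}" "a' < b'" by (rule ivlsE[OF image_ivls[OF L(2)]])
    have "b \<le> a' \<or> b' \<le> a"
    proof (rule ccontr)
      assume "\<not> ?thesis"
      then have "max a a' < min b b'" using ab ab' by auto
      then have "ev_overlap f L1 L2"
        using ab ab' by (intro ev_overlapI[OF L(1,2), of "max a a'" n "min b b'"]) auto
      then show False using L(3) False by simp
    qed
    moreover have "(f ^^ n) u \<in> {a..b}" "(f ^^ n) v \<in> {a..b}" "(f ^^ n) w \<in> {a'..b'}"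
      using n w ab(1) ab'(1) by blast+
    \<comment> \<open>The image of w is not strictly between those of u and v; the farther one of
      these two is at least c away from it and takes the role of u.\<close>
    ultimately have "c \<le> \<bar>(f ^^ n) u - (f ^^ n) w\<bar> \<or> c \<le> \<bar>(f ^^ n) v - (f ^^ n) w\<bar>"
      using n(4) by auto
    then show thesis
      using that[OF n(1-3) w n(4)] that[OF n(1,3,2) w] n(4) by (auto simp: abs_minus_commute)
  qed
qed

text \<open>Near A and B there are finite sets that f^n0 maps into two points, one in L1 and one in
  L2. Bringing these two points together makes both image sets close at once; for separation, one
  set receives a point that is far from both points of the other.\<close>

lemma generically_eps_chaotic_hyperspace:
  assumes c: "c > \<epsilon>" "\<And>J. J \<in> ivls \<Longrightarrow> spread c J"
  shows "generically_eps_chaotic (hyperspace unit_interval) \<epsilon> (induced_map f)"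
proof -
  let ?m = "hyperspace unit_interval"
  let ?T = "prod_topology (mtopology_of ?m) (mtopology_of ?m)"
  \<comment> \<open>Any value strictly between \<epsilon> and c: above \<epsilon> for the upper
    limit, below c because the open condition \<open>Q\<close> is strict.\<close>
  define c' where "c' = (\<epsilon> + c) / 2"
  have c': "\<epsilon> < c'" "c' < c" using c(1) by (auto simp: c'_def)
  define E where "E = (\<lambda>N W. {(A, B). A \<in> hyp \<and> B \<in> hyp \<and> (\<exists>n\<ge>N. hd_dist ((f ^^ n) ` A) ((f ^^ n) ` B) \<in> W)})"
  define P where "P = (\<lambda>k::nat. E k {..<inverse (real (Suc k))})"
  define Q where "Q = (\<lambda>k::nat. E k {c'<..})"
  have op: "openin ?T (P k)" "openin ?T (Q k)" for k
    unfolding P_def Q_def E_def by (rule openin_image_dist; simp)+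
  have core: "mball_of ?m A r \<times> mball_of ?m B r \<inter> P k \<noteq> {}"
    "mball_of ?m A r \<times> mball_of ?m B r \<inter> Q k \<noteq> {}"
    if A: "A \<in> mspace ?m" and B: "B \<in> mspace ?m" and r: "r > 0" for A B r k
  proof -
    have AB: "A \<in> hyp" "B \<in> hyp" using A B by (simp_all add: mspace_hyperspace)
    obtain F where F: "finite F" "F \<noteq> {}" "F \<subseteq> {0..1}" "\<And>c. (\<And>a. a \<in> F \<Longrightarrow> c a \<in> {0..1} \<and> \<bar>c a - a\<bar> \<le> r / 4) \<Longrightarrow>
        c ` F \<in> hyp \<and> hd_dist A (c ` F) < r" by (rule hyp_finite_approx[OF AB(1) r]) blast
    obtain G where G: "finite G" "G \<noteq> {}" "G \<subseteq> {0..1}" "\<And>c. (\<And>a. a \<in> G \<Longrightarrow> c a \<in> {0..1} \<and> \<bar>c a - a\<bar> \<le> r / 4) \<Longrightarrow>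
        c ` G \<in> hyp \<and> hd_dist B (c ` G) < r" by (rule hyp_finite_approx[OF AB(2) r]) blast
    define J where "J = (\<lambda>a. {max 0 (a - r / 4)..min 1 (a + r / 4)})"
    have Jiv: "J a \<in> ivls" if "a \<in> {0..1}" for a
      unfolding J_def using that r by (intro ivlsI) auto
    have Jn: "q \<in> {0..1} \<and> \<bar>q - a\<bar> \<le> r / 4" if "q \<in> J a" for q a
      using that by (auto simp: J_def abs_real_def)
    obtain a0 where a0: "a0 \<in> F" using F(2) by blast
    have "finite (J ` (F \<union> G))" "J ` (F \<union> G) \<subseteq> ivls" "J a0 \<in> J ` (F \<union> G)"
      using F G Jiv a0 by auto
    from finite_cluster_separated[OF this] obtain n0 L1 L2 where
      L: "L1 \<in> ivls" "L2 \<in> ivls" "L1 \<subseteq> (f ^^ n0) ` J a0"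
      "\<And>a. a \<in> F \<union> G \<Longrightarrow> L1 \<subseteq> (f ^^ n0) ` J a \<or> L2 \<subseteq> (f ^^ n0) ` J a"
      "L1 = L2 \<or> \<not> ev_overlap f L1 L2" by (metis imageI)
    \<comment> \<open>Each point can be steered to p or to q at time n0, depending only on its
      cluster; L1 has precedence where both are possible.\<close>
    have pick: "\<exists>s. \<forall>a\<in>F \<union> G. s a \<in> J a \<and>
        (if L1 \<subseteq> (f ^^ n0) ` J a then (f ^^ n0) (s a) = p else (f ^^ n0) (s a) = q)"
      if "p \<in> L1" "q \<in> L2" for p q
    proof (rule bchoice, rule ballI)
      fix a assume "a \<in> F \<union> G"
      then show "\<exists>y. y \<in> J a \<and> (if L1 \<subseteq> (f ^^ n0) ` J a then (f ^^ n0) y = p else (f ^^ n0) y = q)"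
        using L(4)[of a] that by (cases "L1 \<subseteq> (f ^^ n0) ` J a") auto
    qed
    have near: "s ` F \<in> hyp" "t ` G \<in> hyp" "s ` F \<in> mball_of ?m A r" "t ` G \<in> mball_of ?m B r"
      if s: "\<And>a. a \<in> F \<union> G \<Longrightarrow> s a \<in> J a" and t: "\<And>a. a \<in> F \<union> G \<Longrightarrow> t a \<in> J a" for s t
      using F(4)[of s] G(4)[of t] Jn s t A B by (auto simp: mspace_hyperspace mdist_hyperspace)
    have im: "(f ^^ (n + n0)) x = (f ^^ n) ((f ^^ n0) x)" for n x by (simp add: funpow_add)
    show "mball_of ?m A r \<times> mball_of ?m B r \<inter> P k \<noteq> {}"
    proof -
      obtain n x y where n: "n \<ge> k" "x \<in> L1" "y \<in> L2" "\<bar>(f ^^ n) x - (f ^^ n) y\<bar> < inverse (real (Suc k))"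
        using prox_ge[OF L(1,2), of "inverse (real (Suc k))" k] by auto
      obtain s where s: "\<And>a. a \<in> F \<union> G \<Longrightarrow> s a \<in> J a \<and>
        (if L1 \<subseteq> (f ^^ n0) ` J a then (f ^^ n0) (s a) = x else (f ^^ n0) (s a) = y)"
        using pick[OF n(2,3)] by blast
      have s': "s ` F \<in> hyp" "s ` G \<in> hyp" "s ` F \<in> mball_of ?m A r" "s ` G \<in> mball_of ?m B r"
        using near[of s s] s by blast+
      have two: "(f ^^ (n + n0)) (s a) \<in> {(f ^^ n) x, (f ^^ n) y}" if "a \<in> F \<union> G" for a
        using s[OF that] by (auto simp: im split: if_splits)
      have cl: "\<bar>(f ^^ (n + n0)) (s a) - (f ^^ (n + n0)) (s b)\<bar> \<le> \<bar>(f ^^ n) x - (f ^^ n) y\<bar>"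
        if "a \<in> F" "b \<in> G" for a b
        using two[of a] two[of b] that by auto
      have "hd_dist ((f ^^ (n + n0)) ` s ` F) ((f ^^ (n + n0)) ` s ` G) \<le> \<bar>(f ^^ n) x - (f ^^ n) y\<bar>"
      proof (rule hd_dist_leI[OF funpow_hyp[OF s'(1)] funpow_hyp[OF s'(2)]])
        obtain b where "b \<in> G" using G(2) by blast
        then show "\<exists>q\<in>(f ^^ (n + n0)) ` s ` G. \<bar>p - q\<bar> \<le> \<bar>(f ^^ n) x - (f ^^ n) y\<bar>"
          if "p \<in> (f ^^ (n + n0)) ` s ` F" for p using that cl by blast
        show "\<exists>p\<in>(f ^^ (n + n0)) ` s ` F. \<bar>p - q\<bar> \<le> \<bar>(f ^^ n) x - (f ^^ n) y\<bar>"
          if "q \<in> (f ^^ (n + n0)) ` s ` G" for q using that cl a0 by blast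
      qed
      then have "(s ` F, s ` G) \<in> P k"
        unfolding P_def E_def using s'(1,2) n(1,4) by (auto intro!: exI[of _ "n + n0"])
      then show ?thesis using s'(3,4) by blast
    qed
    show "mball_of ?m A r \<times> mball_of ?m B r \<inter> Q k \<noteq> {}"
    proof -
      \<comment> \<open>The first set is sent to u and w, the second to v and w. At time n the image
        of u is at least c away from the whole second set, which suffices for the Hausdorff
        distance.\<close>
      obtain n u v w where n: "n \<ge> k" "u \<in> L1" "v \<in> L1" "w \<in> L2"
        "c \<le> \<bar>(f ^^ n) u - (f ^^ n) v\<bar>" "c \<le> \<bar>(f ^^ n) u - (f ^^ n) w\<bar>"
        by (rule far_points[OF L(1,2,5) c(2)[OF L(1)]])
      obtain s where s: "\<And>a. a \<in> F \<union> G \<Longrightarrow> s a \<in> J a \<and>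
        (if L1 \<subseteq> (f ^^ n0) ` J a then (f ^^ n0) (s a) = u else (f ^^ n0) (s a) = w)"
        using pick[OF n(2,4)] by blast
      obtain t where t: "\<And>a. a \<in> F \<union> G \<Longrightarrow> t a \<in> J a \<and>
        (if L1 \<subseteq> (f ^^ n0) ` J a then (f ^^ n0) (t a) = v else (f ^^ n0) (t a) = w)"
        using pick[OF n(3,4)] by blast
      have st: "s ` F \<in> hyp" "t ` G \<in> hyp" "s ` F \<in> mball_of ?m A r" "t ` G \<in> mball_of ?m B r"
        using near[of s t] s t by blast+
      have u: "(f ^^ n) u \<in> (f ^^ (n + n0)) ` s ` F"
      proof -
        \<comment> \<open>L1 lies in the image of J a0 and a0 belongs to F, so u is really attained
          by the first set.\<close>
        have "(f ^^ n0) (s a0) = u" using s[of a0] a0 L(3) by simp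
        then have "(f ^^ n) u = (f ^^ (n + n0)) (s a0)" by (simp add: im)
        then show ?thesis using a0 by blast
      qed
      have two: "(f ^^ (n + n0)) (t a) \<in> {(f ^^ n) v, (f ^^ n) w}" if "a \<in> F \<union> G" for a
        using t[OF that] by (auto simp: im split: if_splits)
      have "c \<le> hd_dist ((f ^^ (n + n0)) ` s ` F) ((f ^^ (n + n0)) ` t ` G)"
      proof (rule hd_dist_geI[OF funpow_hyp[OF st(1)] funpow_hyp[OF st(2)] u])
        fix y assume "y \<in> (f ^^ (n + n0)) ` t ` G"
        then have "y \<in> {(f ^^ n) v, (f ^^ n) w}" using two by blast
        then show "c \<le> \<bar>(f ^^ n) u - y\<bar>" using n(5,6) by auto
      qed
      then have "(s ` F, t ` G) \<in> Q k"
        unfolding Q_def E_def using st(1,2) n(1) c'(2) by (auto intro!: exI[of _ "n + n0"])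
      then show ?thesis using st(3,4) by blast
    qed
  qed
  show ?thesis unfolding generically_eps_chaotic_def
  proof (rule residual_inI)
    show "countable (range P \<union> range Q)" by simp
    show "eps_chaotic_pairs ?m (induced_map f) \<epsilon> \<subseteq> topspace ?T" by (auto simp: eps_chaotic_pairs_def)
    fix U assume "U \<in> range P \<union> range Q"
    then consider k where "U = P k" | k where "U = Q k" by blast
    then show "openin ?T U \<and> ?T closure_of U = topspace ?T"
    proof cases
      case (1 k)
      show ?thesis unfolding 1 by (intro conjI op dense_prod_mtopologyI core)
    next
      case (2 k)
      show ?thesis unfolding 2 by (intro conjI op dense_prod_mtopologyI core)
    qed
  next
    show "topspace ?T \<inter> \<Inter> (range P \<union> range Q) \<subseteq> eps_chaotic_pairs ?m (induced_map f) \<epsilon>"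
    proof (rule subsetI)
      fix z assume z: "z \<in> topspace ?T \<inter> \<Inter> (range P \<union> range Q)"
      obtain A B where AB: "z = (A, B)" by (cases z)
      have mem: "A \<in> hyp" "B \<in> hyp" using z unfolding AB by (auto simp: mspace_hyperspace)
      have P: "\<exists>n\<ge>k. hd_dist ((f ^^ n) ` A) ((f ^^ n) ` B) < inverse (real (Suc k))" for k
      proof -
        have "(A, B) \<in> P k" using z AB by blast
        then show ?thesis unfolding P_def E_def by auto
      qed
      have Q: "\<exists>n\<ge>k. c' < hd_dist ((f ^^ n) ` A) ((f ^^ n) ` B)" for k
      proof -
        have "(A, B) \<in> Q k" using z AB by blast
        then show ?thesis unfolding Q_def E_def by auto
      qed
      have "\<exists>n\<ge>N. hd_dist ((f ^^ n) ` A) ((f ^^ n) ` B) < e" if e: "e > 0" for e N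
      proof -
        obtain k where k: "inverse (real (Suc k)) < e" using reals_Archimedean[OF e] by blast
        \<comment> \<open>In \<open>P\<close> one index bounds both the time and the distance; the
          maximum secures both.\<close>
        have "inverse (real (Suc (max k N))) \<le> inverse (real (Suc k))"
          by (rule le_imp_inverse_le) auto
        then show ?thesis using P[of "max k N"] k by (meson less_le_trans less_trans max.boundedE order.trans)
      qed
      then have "liminf (\<lambda>n. ereal (hd_dist ((f ^^ n) ` A) ((f ^^ n) ` B))) = 0"
        by (subst liminf_ereal_eq_0_iff) (auto simp: hausdorff_dist_nonneg)
      moreover have "ereal \<epsilon> < limsup (\<lambda>n. ereal (hd_dist ((f ^^ n) ` A) ((f ^^ n) ` B)))"
        by (rule limsup_ereal_gtI[OF Q c'(1)])
      ultimately show "z \<in> eps_chaotic_pairs ?m (induced_map f) \<epsilon>"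
        using mem unfolding AB eps_chaotic_pairs_def
        by (simp add: mspace_hyperspace mdist_hyperspace induced_map_funpow)
    qed
  qed
qed

end

text \<open>Covers both the interval itself, embedded by singletons, and its hyperspace.\<close>

locale set_model = interval_map f for f +
  fixes m :: "'a metric" and g :: "'a \<Rightarrow> 'a" and \<sigma> :: "'a \<Rightarrow> real set"
  assumes complete: "completely_metrizable_space (mtopology_of m)"
    and g_in: "x \<in> mspace m \<Longrightarrow> g x \<in> mspace m"
    and \<sigma>_in: "x \<in> mspace m \<Longrightarrow> \<sigma> x \<in> hyp"
    and \<sigma>_g: "x \<in> mspace m \<Longrightarrow> \<sigma> (g x) = f ` \<sigma> x"
    and \<sigma>_dist: "x \<in> mspace m \<Longrightarrow> y \<in> mspace m \<Longrightarrow> mdist m x y = hd_dist (\<sigma> x) (\<sigma> y)"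
    and \<sigma>_singleton: "t \<in> {0..1} \<Longrightarrow> \<exists>x\<in>mspace m. \<sigma> x = {t}"
    and \<sigma>_finite: "x \<in> mspace m \<Longrightarrow> r > 0 \<Longrightarrow> \<exists>F s. finite F \<and> F \<noteq> {} \<and> F \<subseteq> {0..1} \<and> s > 0 \<and>
      (\<forall>c. (\<forall>a\<in>F. c a \<in> {0..1} \<and> \<bar>c a - a\<bar> \<le> s) \<longrightarrow> (\<exists>y\<in>mspace m. \<sigma> y = c ` F \<and> mdist m x y < r))"
begin

lemma g_funpow_in: "x \<in> mspace m \<Longrightarrow> (g ^^ n) x \<in> mspace m"
  by (induction n) (auto simp: g_in)

lemma \<sigma>_funpow: "x \<in> mspace m \<Longrightarrow> \<sigma> ((g ^^ n) x) = (f ^^ n) ` \<sigma> x"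
  by (induction n) (auto simp: \<sigma>_g g_funpow_in image_comp)

lemma mdist_funpow:
  "x \<in> mspace m \<Longrightarrow> y \<in> mspace m \<Longrightarrow>
    mdist m ((g ^^ n) x) ((g ^^ n) y) = hd_dist ((f ^^ n) ` \<sigma> x) ((f ^^ n) ` \<sigma> y)"
  by (simp add: \<sigma>_dist g_funpow_in \<sigma>_funpow)

text \<open>\<sigma> preserves distances, so every element of V within t of z is represented by a
  set in the t-neighbourhood of \<sigma> z.\<close>

lemma shrink:
  assumes V: "openin (mtopology_of m) V" and z: "z \<in> V" and t: "t > 0"
    and X: "\<And>p q. p \<in> \<sigma> z \<Longrightarrow> q \<in> {0..1} \<Longrightarrow> \<bar>p - q\<bar> < t \<Longrightarrow> q \<in> X"
  shows "\<exists>W. openin (mtopology_of m) W \<and> W \<noteq> {} \<and> W \<subseteq> V \<and> (\<forall>x\<in>W. \<sigma> x \<subseteq> X)"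
proof -
  let ?W = "V \<inter> mball_of m z t"
  have zm: "z \<in> mspace m" using openin_subset[OF V] z by auto
  have "\<sigma> x \<subseteq> X" if x: "x \<in> ?W" for x
  proof
    fix q assume q: "q \<in> \<sigma> x"
    have xm: "x \<in> mspace m" "mdist m z x < t" using x by auto
    then have "hd_dist (\<sigma> x) (\<sigma> z) < t" using \<sigma>_dist[OF zm xm(1)] by (simp add: hausdorff_dist_commute)
    then obtain p where "p \<in> \<sigma> z" "\<bar>q - p\<bar> < t"
      using hd_dist_lessD[OF \<sigma>_in[OF xm(1)] \<sigma>_in[OF zm] _ q] by blast
    moreover have "q \<in> {0..1}" using \<sigma>_in[OF xm(1)] q by (auto simp: hyperspace_unit_interval_iff)
    ultimately show "q \<in> X" using X[of p q] by (simp add: abs_minus_commute)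
  qed
  moreover have "openin (mtopology_of m) ?W" using V openin_mball_of by (rule openin_Int)
  moreover have "mdist m z z = 0" using zm by simp
  then have "mdist m z z < t" using t by linarith
  then have "z \<in> ?W" using z zm by simp
  ultimately show ?thesis by (intro exI[of _ ?W]) blast
qed

lemma ivls_ball:
  assumes "J \<in> ivls"
  obtains p t where "p \<in> J" "t > 0" "\<And>q. \<bar>p - q\<bar> < t \<Longrightarrow> q \<in> J"
proof -
  obtain a b where J: "J = {a..b}" "a < b" using assms by (rule ivlsE)
  have *: "q \<in> J" if "\<bar>(a + b) / 2 - q\<bar> < (b - a) / 2" for q
  proof -
    have "(a + b) / 2 - q < (b - a) / 2" "q - (a + b) / 2 < (b - a) / 2" using that by linarith+
    then show ?thesis unfolding J by (simp add: field_simps)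
  qed
  show thesis by (rule that[of "(a + b) / 2" "(b - a) / 2", OF _ _ *]) (use J in auto)
qed

lemma thin_open:
  assumes J: "J \<in> ivls"
  obtains V where "openin (mtopology_of m) V" "V \<noteq> {}" "\<And>x. x \<in> V \<Longrightarrow> \<sigma> x \<subseteq> J"
proof -
  obtain p t where pt: "p \<in> J" "t > 0" "\<And>q. \<bar>p - q\<bar> < t \<Longrightarrow> q \<in> J" by (rule ivls_ball[OF J]) blast
  have "p \<in> {0..1}" using pt(1) ivls_subset[OF J] by blast
  then obtain z where z: "z \<in> mspace m" "\<sigma> z = {p}" using \<sigma>_singleton by blast
  have "openin (mtopology_of m) (mspace m)"
    using openin_topspace[of "mtopology_of m"] by simp
  moreover have "q \<in> J" if "p' \<in> \<sigma> z" "\<bar>p' - q\<bar> < t" for p' q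
    using pt(3)[of q] that z(2) by simp
  ultimately obtain W where "openin (mtopology_of m) W" "W \<noteq> {}" "\<And>x. x \<in> W \<Longrightarrow> \<sigma> x \<subseteq> J"
    using shrink[of "mspace m" z t J] z(1) pt(2) by metis
  then show thesis by (rule that)
qed

lemma finite_perturbation:
  assumes V: "openin (mtopology_of m) V" "V \<noteq> {}"
  obtains F s where "finite F" "F \<noteq> {}" "F \<subseteq> {0..1}" "s > 0"
    "\<And>c. (\<And>a. a \<in> F \<Longrightarrow> c a \<in> {0..1} \<and> \<bar>c a - a\<bar> \<le> s) \<Longrightarrow> \<exists>y\<in>V. \<sigma> y = c ` F"
proof -
  obtain x where x: "x \<in> V" using V(2) by blast
  then obtain r where r: "r > 0" "mball_of m x r \<subseteq> V" using V(1) unfolding openin_mtopology_of by blast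
  have xm: "x \<in> mspace m" using openin_subset[OF V(1)] x by auto
  obtain F s where F: "finite F" "F \<noteq> {}" "F \<subseteq> {0..1}" "s > 0"
    "\<forall>c. (\<forall>a\<in>F. c a \<in> {0..1} \<and> \<bar>c a - a\<bar> \<le> s) \<longrightarrow> (\<exists>y\<in>mspace m. \<sigma> y = c ` F \<and> mdist m x y < r)"
    using \<sigma>_finite[OF xm r(1)] by (elim exE conjE) (rule that)
  show thesis
  proof (rule that[OF F(1-4)])
    fix c assume "\<And>a. a \<in> F \<Longrightarrow> c a \<in> {0..1} \<and> \<bar>c a - a\<bar> \<le> s"
    then obtain y where "y \<in> mspace m" "\<sigma> y = c ` F" "mdist m x y < r" using F(5) by meson
    then show "\<exists>y\<in>V. \<sigma> y = c ` F" using r(2) xm by (intro bexI[of _ y]) auto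
  qed
qed

text \<open>\<R> consists of the intervals of radius s, cut to [0,1], around the points of a finite
  set represented in V. A choice of smaller intervals inside them singles out a nonempty open part
  of V, so density in V becomes a statement about finite families of intervals.\<close>

lemma perturbation_family:
  assumes V: "openin (mtopology_of m) V" "V \<noteq> {}"
  obtains \<R> where "finite \<R>" "\<R> \<noteq> {}" "\<R> \<subseteq> ivls" "\<And>R p. R \<in> \<R> \<Longrightarrow> p \<in> R \<Longrightarrow> \<exists>x\<in>V. p \<in> \<sigma> x"
    "\<And>r. (\<And>R. R \<in> \<R> \<Longrightarrow> r R \<in> ivls \<and> r R \<subseteq> R) \<Longrightarrow>
      \<exists>W. openin (mtopology_of m) W \<and> W \<noteq> {} \<and> W \<subseteq> V \<and> (\<forall>x\<in>W. \<sigma> x \<subseteq> (\<Union>R\<in>\<R>. r R))"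
proof -
  obtain F s where F: "finite F" "F \<noteq> {}" "F \<subseteq> {0..1}" "s > 0"
    "\<And>c. (\<And>a. a \<in> F \<Longrightarrow> c a \<in> {0..1} \<and> \<bar>c a - a\<bar> \<le> s) \<Longrightarrow> \<exists>y\<in>V. \<sigma> y = c ` F"
    by (rule finite_perturbation[OF V]) blast
  define I where "I = (\<lambda>a. {max 0 (a - s)..min 1 (a + s)})"
  have Iiv: "I a \<in> ivls" if "a \<in> F" for a
  proof -
    have "a \<in> {0..1}" using that F(3) by blast
    then show ?thesis unfolding I_def using F(4) by (intro ivlsI) auto
  qed
  have In: "q \<in> {0..1} \<and> \<bar>q - a\<bar> \<le> s" if "q \<in> I a" for q a
    using that by (auto simp: I_def abs_real_def)
  show thesis
  proof (rule that[of "I ` F"])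
    show "finite (I ` F)" "I ` F \<noteq> {}" "I ` F \<subseteq> ivls" using F Iiv by auto
    fix R p assume "R \<in> I ` F" "p \<in> R"
    then obtain a where a: "a \<in> F" "p \<in> I a" by blast
    have "\<exists>y\<in>V. \<sigma> y = (\<lambda>b. if b = a then p else b) ` F"
    proof (rule F(5))
      fix b assume "b \<in> F"
      then have "b \<in> {0..1}" using F(3) by blast
      then show "(if b = a then p else b) \<in> {0..1} \<and> \<bar>(if b = a then p else b) - b\<bar> \<le> s"
        using In[OF a(2)] F(4) by simp
    qed
    then show "\<exists>x\<in>V. p \<in> \<sigma> x" using a(1) by force
  next
    fix r assume r: "\<And>R. R \<in> I ` F \<Longrightarrow> r R \<in> ivls \<and> r R \<subseteq> R"
    have "\<forall>a\<in>F. \<exists>p t. p \<in> r (I a) \<and> t > 0 \<and> (\<forall>q. \<bar>p - q\<bar> < t \<longrightarrow> q \<in> r (I a))"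
      using r ivls_ball by (metis imageI)
    then obtain c t where ct: "\<And>a. a \<in> F \<Longrightarrow> c a \<in> r (I a)" "\<And>a. a \<in> F \<Longrightarrow> t a > (0::real)"
      "\<And>a q. a \<in> F \<Longrightarrow> \<bar>c a - q\<bar> < t a \<Longrightarrow> q \<in> r (I a)" by metis
    have "\<exists>y\<in>V. \<sigma> y = c ` F"
      by (rule F(5)) (use ct(1) r In in blast)
    then obtain z where z: "z \<in> V" "\<sigma> z = c ` F" by blast
    define d where "d = Min (t ` F)"
    have d: "d > 0" "\<And>a. a \<in> F \<Longrightarrow> d \<le> t a" unfolding d_def using F(1,2) ct(2) by auto
    have *: "q \<in> (\<Union>R\<in>I ` F. r R)" if pq: "p \<in> \<sigma> z" "q \<in> {0..1}" "\<bar>p - q\<bar> < d" for p q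
    proof -
      obtain a where a: "a \<in> F" "p = c a" using pq(1) z(2) by blast
      then have "q \<in> r (I a)" using ct(3)[of a q] d(2)[of a] pq(3) by simp
      then show ?thesis using a(1) by blast
    qed
    show "\<exists>W. openin (mtopology_of m) W \<and> W \<noteq> {} \<and> W \<subseteq> V \<and> (\<forall>x\<in>W. \<sigma> x \<subseteq> (\<Union>R\<in>I ` F. r R))"
      by (rule shrink[OF V(1) z(1) d(1) *])
  qed
qed

section \<open>Consequences of generic chaos for intervals\<close>

context
  fixes \<epsilon> :: real
  assumes gen: "generically_eps_chaotic m \<epsilon> g" and eps: "\<epsilon> \<ge> 0"
begin

lemma eps_chaotic_pairD:
  assumes "(x, y) \<in> eps_chaotic_pairs m g \<epsilon>"
  shows "x \<in> mspace m" "y \<in> mspace m"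
    "e > 0 \<Longrightarrow> \<exists>n\<ge>N. hd_dist ((f ^^ n) ` \<sigma> x) ((f ^^ n) ` \<sigma> y) < e"
    "\<exists>k. \<forall>N. \<exists>n\<ge>N. \<epsilon> + inverse (real (Suc k)) < hd_dist ((f ^^ n) ` \<sigma> x) ((f ^^ n) ` \<sigma> y)"
proof -
  show m: "x \<in> mspace m" "y \<in> mspace m" using assms by (auto simp: eps_chaotic_pairs_def)
  have l: "liminf (\<lambda>n. ereal (hd_dist ((f ^^ n) ` \<sigma> x) ((f ^^ n) ` \<sigma> y))) = 0"
    "ereal \<epsilon> < limsup (\<lambda>n. ereal (hd_dist ((f ^^ n) ` \<sigma> x) ((f ^^ n) ` \<sigma> y)))"
    using assms m by (auto simp: eps_chaotic_pairs_def mdist_funpow)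
  show "\<exists>n\<ge>N. hd_dist ((f ^^ n) ` \<sigma> x) ((f ^^ n) ` \<sigma> y) < e" if "e > 0"
    using l(1) that by (subst (asm) liminf_ereal_eq_0_iff) (auto simp: hausdorff_dist_nonneg)
  show "\<exists>k. \<forall>N. \<exists>n\<ge>N. \<epsilon> + inverse (real (Suc k)) < hd_dist ((f ^^ n) ` \<sigma> x) ((f ^^ n) ` \<sigma> y)"
    using limsup_ereal_gt_imp[OF l(2)] .
qed

text \<open>Residual sets are dense: the rectangle lemma is used with a constant family over a
  one-element index type.\<close>

lemma chaotic_pair_in_intervals:
  assumes "J \<in> ivls" "L \<in> ivls"
  obtains x y where "(x, y) \<in> eps_chaotic_pairs m g \<epsilon>" "\<sigma> x \<subseteq> J" "\<sigma> y \<subseteq> L"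
proof -
  obtain V where V: "openin (mtopology_of m) V" "V \<noteq> {}" "\<And>x. x \<in> V \<Longrightarrow> \<sigma> x \<subseteq> J"
    by (rule thin_open[OF assms(1)]) blast
  obtain V' where V': "openin (mtopology_of m) V'" "V' \<noteq> {}" "\<And>x. x \<in> V' \<Longrightarrow> \<sigma> x \<subseteq> L"
    by (rule thin_open[OF assms(2)]) blast
  let ?S = "eps_chaotic_pairs m g \<epsilon>"
  have "openin (prod_topology (mtopology_of m) (mtopology_of m)) (V \<times> V')"
    using V V' by (simp add: openin_prod_Times_iff)
  moreover have "V \<times> V' \<noteq> {}" using V V' by blast
  ultimately obtain W W' where W: "openin (mtopology_of m) W" "openin (mtopology_of m) W'" "W \<noteq> {}" "W' \<noteq> {}"
    "W \<times> W' \<subseteq> V \<times> V'"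
    "\<And>W1 W2. openin (mtopology_of m) W1 \<Longrightarrow> openin (mtopology_of m) W2 \<Longrightarrow> W1 \<noteq> {} \<Longrightarrow> W2 \<noteq> {} \<Longrightarrow>
      W1 \<subseteq> W \<Longrightarrow> W2 \<subseteq> W' \<Longrightarrow> W1 \<times> W2 \<inter> ?S \<noteq> {}"
    by (rule residual_in_rectangle[OF complete gen[unfolded generically_eps_chaotic_def],
          of "V \<times> V'" "\<lambda>k::unit. ?S"]) auto
  have "W \<times> W' \<inter> ?S \<noteq> {}" by (rule W(6)[OF W(1-4)]) simp_all
  then obtain x y where "(x, y) \<in> ?S" "x \<in> V" "y \<in> V'" using W(5) by auto
  then show thesis using that V(3) V'(3) by blast
qed

text \<open>A small Hausdorff distance provides close points and a large one distant points, so a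
  chaotic pair of sets inside the given intervals suffices. As \<epsilon> \<ge> 0, the margin above
  \<epsilon> is itself a positive lower bound.\<close>

lemma spreading: "spreading_map f"
proof
  fix J L and \<delta> :: real assume J: "J \<in> ivls" and L: "L \<in> ivls" and \<delta>: "\<delta> > 0"
  obtain x y where xy: "(x, y) \<in> eps_chaotic_pairs m g \<epsilon>" "\<sigma> x \<subseteq> J" "\<sigma> y \<subseteq> L"
    by (rule chaotic_pair_in_intervals[OF J L])
  note xy' = eps_chaotic_pairD[OF xy(1)]
  obtain n where n: "hd_dist ((f ^^ n) ` \<sigma> x) ((f ^^ n) ` \<sigma> y) < \<delta>" using xy'(3)[OF \<delta>] by blast
  obtain p where p: "p \<in> \<sigma> x" using \<sigma>_in[OF xy'(1)] by (auto simp: hyperspace_unit_interval_iff)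
  then have "(f ^^ n) p \<in> (f ^^ n) ` \<sigma> x" by blast
  from hd_dist_lessD[OF funpow_hyp[OF \<sigma>_in[OF xy'(1)]] funpow_hyp[OF \<sigma>_in[OF xy'(2)]] n this]
  obtain q where "q \<in> \<sigma> y" "\<bar>(f ^^ n) p - (f ^^ n) q\<bar> < \<delta>" by blast
  then show "\<exists>n. \<exists>x\<in>J. \<exists>y\<in>L. \<bar>(f ^^ n) x - (f ^^ n) y\<bar> < \<delta>" using p xy(2,3) by blast
next
  fix J assume J: "J \<in> ivls"
  obtain x y where xy: "(x, y) \<in> eps_chaotic_pairs m g \<epsilon>" "\<sigma> x \<subseteq> J" "\<sigma> y \<subseteq> J"
    by (rule chaotic_pair_in_intervals[OF J J])
  note xy' = eps_chaotic_pairD[OF xy(1)]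
  obtain k where k: "\<And>N. \<exists>n\<ge>N. \<epsilon> + inverse (real (Suc k)) < hd_dist ((f ^^ n) ` \<sigma> x) ((f ^^ n) ` \<sigma> y)"
    using xy'(4) by blast
  have "\<exists>n\<ge>N. \<exists>x\<in>J. \<exists>y\<in>J. inverse (real (Suc k)) \<le> \<bar>(f ^^ n) x - (f ^^ n) y\<bar>" for N
  proof -
    obtain n where n: "n \<ge> N" "\<epsilon> + inverse (real (Suc k)) < hd_dist ((f ^^ n) ` \<sigma> x) ((f ^^ n) ` \<sigma> y)"
      using k by blast
    from hd_dist_greaterD[OF funpow_hyp[OF \<sigma>_in[OF xy'(1)]] funpow_hyp[OF \<sigma>_in[OF xy'(2)]] n(2)]
    obtain p q where pq: "p \<in> \<sigma> x" "q \<in> \<sigma> y" "\<epsilon> + inverse (real (Suc k)) < \<bar>(f ^^ n) p - (f ^^ n) q\<bar>"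
      by blast
    then have "inverse (real (Suc k)) \<le> \<bar>(f ^^ n) p - (f ^^ n) q\<bar>" using eps by linarith
    then show ?thesis using pq(1,2) xy(2,3) n(1) by blast
  qed
  moreover have "inverse (real (Suc k)) > 0" by simp
  ultimately show "\<exists>d>0. \<forall>N. \<exists>n\<ge>N. \<exists>x\<in>J. \<exists>y\<in>J. d \<le> \<bar>(f ^^ n) x - (f ^^ n) y\<bar>" by blast
qed

interpretation spreading_map f by (rule spreading)

text \<open>The chaotic pairs are sorted by their margin above \<epsilon>; some class D k is dense
  in a rectangle V1 \<times> V2. The families of both factors are united because the distant points
  come from different factors.\<close>

lemma spread_family:
  assumes J: "J \<in> ivls"
  shows "\<exists>\<delta>>0. \<exists>\<R>. finite \<R> \<and> \<R> \<noteq> {} \<and> \<R> \<subseteq> ivls \<and> \<Union>\<R> \<subseteq> J \<and>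
      (\<forall>r. (\<forall>R\<in>\<R>. r R \<in> ivls \<and> r R \<subseteq> R) \<longrightarrow> spread (\<epsilon> + \<delta>) (\<Union>R\<in>\<R>. r R))"
proof -
  let ?S = "eps_chaotic_pairs m g \<epsilon>"
  obtain V where V: "openin (mtopology_of m) V" "V \<noteq> {}" "\<And>x. x \<in> V \<Longrightarrow> \<sigma> x \<subseteq> J"
    by (rule thin_open[OF J]) blast
  define D where "D = (\<lambda>k. {(x, y). x \<in> mspace m \<and> y \<in> mspace m \<and>
    (\<forall>N. \<exists>n\<ge>N. \<epsilon> + inverse (real (Suc k)) < hd_dist ((f ^^ n) ` \<sigma> x) ((f ^^ n) ` \<sigma> y))})"
  have op: "openin (prod_topology (mtopology_of m) (mtopology_of m)) (V \<times> V)"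
    using V by (simp add: openin_prod_Times_iff)
  have ne: "V \<times> V \<noteq> {}" using V(2) by blast
  have "p \<in> (\<Union>k. D k)" if p: "p \<in> ?S" for p
  proof -
    obtain x y where xy: "p = (x, y)" by (cases p)
    obtain k where "\<forall>N. \<exists>n\<ge>N. \<epsilon> + inverse (real (Suc k)) < hd_dist ((f ^^ n) ` \<sigma> x) ((f ^^ n) ` \<sigma> y)"
      using eps_chaotic_pairD(4)[OF p[unfolded xy]] by (elim exE) (rule that)
    then have "p \<in> D k" using eps_chaotic_pairD(1,2)[OF p[unfolded xy]] unfolding D_def xy by simp
    then show ?thesis by blast
  qed
  then have sub: "?S \<inter> V \<times> V \<subseteq> (\<Union>k. D k)" by blast
  obtain k V1 V2 where W: "openin (mtopology_of m) V1" "openin (mtopology_of m) V2" "V1 \<noteq> {}" "V2 \<noteq> {}"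
    "V1 \<times> V2 \<subseteq> V \<times> V"
    "\<And>W1 W2. openin (mtopology_of m) W1 \<Longrightarrow> openin (mtopology_of m) W2 \<Longrightarrow> W1 \<noteq> {} \<Longrightarrow> W2 \<noteq> {} \<Longrightarrow>
      W1 \<subseteq> V1 \<Longrightarrow> W2 \<subseteq> V2 \<Longrightarrow> W1 \<times> W2 \<inter> D k \<noteq> {}"
    by (rule residual_in_rectangle[OF complete gen[unfolded generically_eps_chaotic_def] op ne sub]) auto
  have V12: "V1 \<subseteq> V" "V2 \<subseteq> V" using W(3-5) by blast+
  obtain \<R>1 where R1: "finite \<R>1" "\<R>1 \<noteq> {}" "\<R>1 \<subseteq> ivls" "\<And>R p. R \<in> \<R>1 \<Longrightarrow> p \<in> R \<Longrightarrow> \<exists>x\<in>V1. p \<in> \<sigma> x"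
    "\<And>r. (\<And>R. R \<in> \<R>1 \<Longrightarrow> r R \<in> ivls \<and> r R \<subseteq> R) \<Longrightarrow>
      \<exists>W. openin (mtopology_of m) W \<and> W \<noteq> {} \<and> W \<subseteq> V1 \<and> (\<forall>x\<in>W. \<sigma> x \<subseteq> (\<Union>R\<in>\<R>1. r R))"
    by (rule perturbation_family[OF W(1,3)]) blast
  obtain \<R>2 where R2: "finite \<R>2" "\<R>2 \<noteq> {}" "\<R>2 \<subseteq> ivls" "\<And>R p. R \<in> \<R>2 \<Longrightarrow> p \<in> R \<Longrightarrow> \<exists>x\<in>V2. p \<in> \<sigma> x"
    "\<And>r. (\<And>R. R \<in> \<R>2 \<Longrightarrow> r R \<in> ivls \<and> r R \<subseteq> R) \<Longrightarrow>
      \<exists>W. openin (mtopology_of m) W \<and> W \<noteq> {} \<and> W \<subseteq> V2 \<and> (\<forall>x\<in>W. \<sigma> x \<subseteq> (\<Union>R\<in>\<R>2. r R))"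
    by (rule perturbation_family[OF W(2,4)]) blast
  define \<delta> where "\<delta> = inverse (real (Suc k))"
  have main: "spread (\<epsilon> + \<delta>) (\<Union>R\<in>\<R>1 \<union> \<R>2. r R)"
    if r: "\<forall>R\<in>\<R>1 \<union> \<R>2. r R \<in> ivls \<and> r R \<subseteq> R" for r
  proof -
    obtain W1 where W1: "openin (mtopology_of m) W1" "W1 \<noteq> {}" "W1 \<subseteq> V1" "\<forall>x\<in>W1. \<sigma> x \<subseteq> (\<Union>R\<in>\<R>1. r R)"
      using R1(5)[of r] r by (metis UnI1)
    obtain W2 where W2: "openin (mtopology_of m) W2" "W2 \<noteq> {}" "W2 \<subseteq> V2" "\<forall>x\<in>W2. \<sigma> x \<subseteq> (\<Union>R\<in>\<R>2. r R)"
      using R2(5)[of r] r by (metis UnI2)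
    have "W1 \<times> W2 \<inter> D k \<noteq> {}" using W(6) W1(1-3) W2(1-3) by blast
    then obtain x y where xy: "x \<in> W1" "y \<in> W2" "(x, y) \<in> D k" by auto
    have m: "x \<in> mspace m" "y \<in> mspace m" using xy(3) by (auto simp: D_def)
    have sub: "\<sigma> x \<subseteq> (\<Union>R\<in>\<R>1 \<union> \<R>2. r R)" "\<sigma> y \<subseteq> (\<Union>R\<in>\<R>1 \<union> \<R>2. r R)"
      using W1(4) W2(4) xy(1,2) by blast+
    show ?thesis unfolding spread_def
    proof
      fix N
      obtain n where n: "n \<ge> N" "\<epsilon> + \<delta> < hd_dist ((f ^^ n) ` \<sigma> x) ((f ^^ n) ` \<sigma> y)"
        using xy(3) unfolding D_def \<delta>_def by blast
      from hd_dist_greaterD[OF funpow_hyp[OF \<sigma>_in[OF m(1)]] funpow_hyp[OF \<sigma>_in[OF m(2)]] n(2)]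
      obtain p q where pq: "p \<in> \<sigma> x" "q \<in> \<sigma> y" "\<epsilon> + \<delta> < \<bar>(f ^^ n) p - (f ^^ n) q\<bar>" by blast
      have "p \<in> (\<Union>R\<in>\<R>1 \<union> \<R>2. r R)" "q \<in> (\<Union>R\<in>\<R>1 \<union> \<R>2. r R)" using pq(1,2) sub by blast+
      then show "\<exists>n\<ge>N. \<exists>x\<in>\<Union>R\<in>\<R>1 \<union> \<R>2. r R. \<exists>y\<in>\<Union>R\<in>\<R>1 \<union> \<R>2. r R. \<epsilon> + \<delta> \<le> \<bar>(f ^^ n) x - (f ^^ n) y\<bar>"
        using n(1) less_imp_le[OF pq(3)] by (intro exI[of _ n] conjI bexI[of _ p] bexI[of _ q])
    qed
  qed
  have "\<Union>(\<R>1 \<union> \<R>2) \<subseteq> J"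
  proof
    fix p assume "p \<in> \<Union>(\<R>1 \<union> \<R>2)"
    then have "\<exists>x\<in>V1 \<union> V2. p \<in> \<sigma> x" using R1(4) R2(4) by blast
    then show "p \<in> J" using V12 V(3) by blast
  qed
  moreover have "\<delta> > 0" by (simp add: \<delta>_def)
  ultimately show ?thesis
    using R1(1-3) R2(1-3) main
    by (intro exI[of _ \<delta>] conjI exI[of _ "\<R>1 \<union> \<R>2"] allI impI) auto
qed

text \<open>The strict gain c > \<epsilon> matters for \<epsilon> = 0: there it produces a positive
  constant from mere generic chaos.\<close>

theorem hyperspace_generically_chaotic:
  obtains c where "c > \<epsilon>" "\<And>\<epsilon>'. \<epsilon>' < c \<Longrightarrow> generically_eps_chaotic (hyperspace unit_interval) \<epsilon>' (induced_map f)"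
proof -
  obtain c where c: "c > \<epsilon>" "\<And>J. J \<in> ivls \<Longrightarrow> spread c J"
    by (rule uniform_spread[OF spread_family]) blast+
  show thesis by (rule that[OF c(1) generically_eps_chaotic_hyperspace[OF _ c(2)]])
qed

end

end

section \<open>Points and sets as models, and the conclusion\<close>

lemma set_model_interval:
  assumes "interval_map f"
  shows "set_model f unit_interval f (\<lambda>x. {x})"
proof -
  interpret interval_map f by fact
  show ?thesis
  proof
    show "completely_metrizable_space (mtopology_of unit_interval)"
      unfolding mtopology_of_submetric mtopology_of_euclidean
      by (rule completely_metrizable_space_closedin[OF completely_metrizable_space_euclidean]) simp
  next
    fix x r :: real assume "x \<in> mspace unit_interval" "r > 0"
    then show "\<exists>F s. finite F \<and> F \<noteq> {} \<and> F \<subseteq> {0..1} \<and> s > 0 \<and>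
      (\<forall>c. (\<forall>a\<in>F. c a \<in> {0..1} \<and> \<bar>c a - a\<bar> \<le> s) \<longrightarrow>
        (\<exists>y\<in>mspace unit_interval. {y} = c ` F \<and> mdist unit_interval x y < r))"
      by (intro exI[of _ "{x}"] exI[of _ "r / 2"]) (auto simp: dist_real_def abs_minus_commute)
  qed (use maps in \<open>auto simp: finite_in_hyp hd_dist_singleton dist_real_def\<close>)
qed

lemma set_model_hyperspace:
  assumes "interval_map f"
  shows "set_model f (hyperspace unit_interval) (induced_map f) (\<lambda>A. A)"
proof -
  interpret interval_map f by fact
  show ?thesis
  proof
    fix A r assume A: "A \<in> mspace (hyperspace unit_interval)" and r: "(r::real) > 0"
    have A': "A \<in> hyp" using A by (simp add: mspace_hyperspace)
    obtain F where F: "finite F" "F \<noteq> {}" "F \<subseteq> {0..1}" "\<And>c. (\<And>a. a \<in> F \<Longrightarrow> c a \<in> {0..1} \<and> \<bar>c a - a\<bar> \<le> r / 4) \<Longrightarrow>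
        c ` F \<in> hyp \<and> hd_dist A (c ` F) < r" by (rule hyp_finite_approx[OF A' r]) blast
    show "\<exists>F s. finite F \<and> F \<noteq> {} \<and> F \<subseteq> {0..1} \<and> s > 0 \<and>
      (\<forall>c. (\<forall>a\<in>F. c a \<in> {0..1} \<and> \<bar>c a - a\<bar> \<le> s) \<longrightarrow>
        (\<exists>y\<in>mspace (hyperspace unit_interval). y = c ` F \<and> mdist (hyperspace unit_interval) A y < r))"
      using F r by (intro exI[of _ F] exI[of _ "r / 4"]) (auto simp: mspace_hyperspace mdist_hyperspace)
  next
    show "f ` A \<in> mspace (hyperspace unit_interval)" if "A \<in> mspace (hyperspace unit_interval)" for A
      using funpow_hyp[of A 1] that by (simp add: mspace_hyperspace)
  qed (auto simp: mspace_hyperspace mdist_hyperspace finite_in_hyp completely_metrizable_hyperspace)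
qed

theorem corollary4p5:
  fixes f :: "real \<Rightarrow> real"
  assumes "continuous_on {0..1} f"
    and "f \<in> {0..1} \<rightarrow> {0..1}"
  shows "(\<forall>\<epsilon>>0. generically_eps_chaotic unit_interval \<epsilon> f \<longrightarrow>
                 generically_eps_chaotic (hyperspace unit_interval) \<epsilon> (induced_map f)) \<and>
         (generically_chaotic unit_interval f \<longrightarrow>
            generically_chaotic (hyperspace unit_interval) (induced_map f)) \<and>
         (generically_chaotic (hyperspace unit_interval) (induced_map f) \<longrightarrow>
            (\<exists>\<epsilon>>0. generically_eps_chaotic (hyperspace unit_interval) \<epsilon> (induced_map f)))"
proof -
  have f: "interval_map f" using assms by unfold_locales
  interpret I: set_model f unit_interval f "\<lambda>x. {x}" by (rule set_model_interval[OF f])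
  interpret H: set_model f "hyperspace unit_interval" "induced_map f" "\<lambda>A. A"
    by (rule set_model_hyperspace[OF f])
  have 1: "generically_eps_chaotic (hyperspace unit_interval) \<epsilon> (induced_map f)"
    if "generically_eps_chaotic unit_interval \<epsilon> f" "\<epsilon> \<ge> 0" for \<epsilon>
    by (rule I.hyperspace_generically_chaotic[OF that])
  have "\<exists>\<epsilon>>0. generically_eps_chaotic (hyperspace unit_interval) \<epsilon> (induced_map f)"
    if gen: "generically_chaotic (hyperspace unit_interval) (induced_map f)"
  proof -
    \<comment> \<open>Generic chaos enters as \<epsilon> = 0; any positive value below c will
      do.\<close>
    obtain c where c: "c > 0" "\<And>\<epsilon>'. \<epsilon>' < c \<Longrightarrow>
        generically_eps_chaotic (hyperspace unit_interval) \<epsilon>' (induced_map f)"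
      by (rule H.hyperspace_generically_chaotic[OF gen[unfolded generically_chaotic_eps_0] order_refl]) blast
    then show ?thesis by (intro exI[of _ "c / 2"]) simp
  qed
  then show ?thesis using 1 by (simp add: generically_chaotic_eps_0 less_imp_le)
qed

end
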